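(* Let $\mathsf H$ be a separable Hilbert space and let $K$ be a geodesically convex set in $\mathcal P_2(\mathsf H)$, i.e. for every $\mu_0,\mu_1\in K$ there exists $\boldsymbol\mu\in\Gamma_o(\mu_0,\mu_1)$ such that $(\pi^{1\to2}_t)_\sharp\boldsymbol\mu\in K$ for every $t\in[0,1]$. If $K$ is closed in $(\mathcal P_2(\mathsf H),W_2)$ then it is also (weakly) sequentially closed in $\mathcal P_2^w(\mathsf H)$. In particular, $$\mu_n\in K,\quad \sup_n\int|x|^2\,\mathrm d\mu_n<\infty,\quad \mu_n\to\mu\text{ narrowly in }\mathcal P(\mathsf H_w)\text{ as }n\to\infty\quad\Longrightarrow\quad\mu\in K.$$
   Context: $(\mathsf H,|\cdot|)$ is a separable Hilbert space; $\mathsf H_w$ denotes $\mathsf H$ with its weak topology. $\mathcal P_2(\mathsf H)$ is the set of Borel probability measures $\mu$ on $\mathsf H$ with $\int|x|^2\,\mathrm d\mu<\infty$. For $\mu_0,\mu_1\in\mathcal P_2(\mathsf H)$, $\Gamma(\mu_0,\mu_1)$ is the set of Borel probability measures on $\mathsf H\times\mathsf H$ with marginals $\mu_0,\mu_1$; $W_2^2(\mu_0,\mu_1)=\min\{\int|x_1-x_2|^2\,\mathrm d\boldsymbol\mu:\boldsymbol\mu\in\Gamma(\mu_0,\mu_1)\}$; $\Gamma_o(\mu_0,\mu_1)$ is the set of minimizers. $\pi^{1\to2}_t(x_1,x_2)=(1-t)x_1+tx_2$ and $\sharp$ denotes push-forward. Narrow convergence in $\mathcal P(\mathsf H_w)$: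 $\int f\,\mathrm d\mu_n\to\int f\,\mathrm d\mu$ for every bounded weakly continuous $f:\mathsf H\to\mathbb R$. $\mathcal P_2^w(\mathsf H)$ is the set $\mathcal P_2(\mathsf H)$ endowed with the coarsest topology making all maps $\mu\mapsto\int\zeta\,\mathrm d\mu$ continuous, where $\zeta:\mathsf H\to\mathbb R$ ranges over the sequentially weakly continuous functions with $\lim_{|x|\to\infty}\zeta(x)/(1+|x|^2)=0$. *)

theory Defs
  imports "HOL-Probability.Probability"
begin

text \<open>A separable Hilbert space is a type of class \<open>{real_inner, polish_space}\<close>: a complete,
  second countable (equivalently, separable) real inner product space.\<close>


subsection \<open>Weak topology\<close>

definition weak_topology :: "'h::real_normed_vector topology" where
  "weak_topology = topology_generated_by
     {f -` U | (f :: 'h \<Rightarrow> real) U. bounded_linear f \<and> open U}"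

definition seq_weakly_continuous :: "('h::real_normed_vector \<Rightarrow> real) \<Rightarrow> bool" where
  "seq_weakly_continuous f \<longleftrightarrow>
     (\<forall>xs x. limitin weak_topology xs x sequentially \<longrightarrow> (\<lambda>n. f (xs n)) \<longlonglongrightarrow> f x)"

lemma topspace_weak_topology [simp]: "topspace (weak_topology :: 'h::real_normed_vector topology) = UNIV"
proof -
  have "UNIV = (\<lambda>_::'h. 0::real) -` UNIV"
    by simp
  then have "(UNIV :: 'h set) \<in> {f -` U | (f :: 'h \<Rightarrow> real) U. bounded_linear f \<and> open U}"
    using bounded_linear_zero open_UNIV by blast
  then show ?thesis
    unfolding weak_topology_def topology_generated_by_topspace by blast
qed

lemma openin_weak_topology_halfspace:
  fixes v :: "'h::real_inner"
  shows "openin weak_topology {x. c < x \<bullet> v}"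
proof -
  have "{x. c < x \<bullet> v} = (\<lambda>x. x \<bullet> v) -` {c<..}"
    by auto
  then show ?thesis
    unfolding weak_topology_def
    by (intro topology_generated_by_Basis) (use bounded_linear_inner_left open_greaterThan in blast)
qed

lemma openin_weak_topology_imp_open: "openin weak_topology U \<Longrightarrow> open U"
  unfolding weak_topology_def openin_topology_generated_by_iff
proof (induction rule: generate_topology_on.induct)
  case (Basis s)
  then show ?case
    by (auto intro!: continuous_open_vimage linear_continuous_at)
qed auto


subsection \<open>Probability measures, transport plans and the Wasserstein distance\<close>

definition borel_prob :: "'a::topological_space measure set" where
  "borel_prob = {\<mu>. prob_space \<mu> \<and> sets \<mu> = sets borel}"

definition second_moment :: "'h::real_normed_vector measure \<Rightarrow> ennreal" where
  "second_moment \<mu> = (\<integral>\<^sup>+ x. ennreal ((norm x)\<^sup>2) \<partial>\<mu>)"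

definition P2 :: "'h::real_normed_vector measure set" where
  "P2 = {\<mu> \<in> borel_prob. second_moment \<mu> < \<infinity>}"

definition couplings ::
    "'h::topological_space measure \<Rightarrow> 'h measure \<Rightarrow> ('h \<times> 'h) measure set" where
  "couplings \<mu> \<nu> = {\<gamma> \<in> borel_prob. distr \<gamma> borel fst = \<mu> \<and> distr \<gamma> borel snd = \<nu>}"

definition transport_cost :: "('h \<times> 'h::real_normed_vector) measure \<Rightarrow> ennreal" where
  "transport_cost \<gamma> = (\<integral>\<^sup>+ (x, y). ennreal ((norm (x - y))\<^sup>2) \<partial>\<gamma>)"

definition optimal_couplings ::
    "'h::real_normed_vector measure \<Rightarrow> 'h measure \<Rightarrow> ('h \<times> 'h) measure set" where
  "optimal_couplings \<mu> \<nu> =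
     {\<gamma> \<in> couplings \<mu> \<nu>. \<forall>\<gamma>' \<in> couplings \<mu> \<nu>. transport_cost \<gamma> \<le> transport_cost \<gamma>'}"

definition W2 :: "'h::real_normed_vector measure \<Rightarrow> 'h measure \<Rightarrow> real" where
  "W2 \<mu> \<nu> = sqrt (enn2real (INF \<gamma> \<in> couplings \<mu> \<nu>. transport_cost \<gamma>))"

text \<open>The metric topology of \<open>(P2, W2)\<close>. It is written out because the facts about
  \<^const>\<open>Metric_space.mtopology\<close> are only available once \<^const>\<open>W2\<close> is known to be a metric.\<close>

definition W2_topology :: "'h::real_normed_vector measure topology" where
  "W2_topology = topology
     (\<lambda>U. U \<subseteq> P2 \<and> (\<forall>\<mu>\<in>U. \<exists>r>0. {\<nu> \<in> P2. W2 \<mu> \<nu> < r} \<subseteq> U))"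

lemma openin_W2_topology:
  "openin W2_topology U \<longleftrightarrow> U \<subseteq> P2 \<and> (\<forall>\<mu>\<in>U. \<exists>r>0. {\<nu> \<in> P2. W2 \<mu> \<nu> < r} \<subseteq> U)"
proof -
  let ?L = "\<lambda>U :: 'a measure set. U \<subseteq> P2 \<and> (\<forall>\<mu>\<in>U. \<exists>r>0. {\<nu> \<in> P2. W2 \<mu> \<nu> < r} \<subseteq> U)"
  have "?L (S \<inter> T)" if S: "?L S" and T: "?L T" for S T
  proof (intro conjI ballI)
    show "S \<inter> T \<subseteq> P2"
      using S by blast
    fix \<mu> assume \<mu>: "\<mu> \<in> S \<inter> T"
    obtain r where "r > 0" "{\<nu> \<in> P2. W2 \<mu> \<nu> < r} \<subseteq> S"
      using S \<mu> by blast
    moreover obtain s where "s > 0" "{\<nu> \<in> P2. W2 \<mu> \<nu> < s} \<subseteq> T"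
      using T \<mu> by blast
    ultimately show "\<exists>r>0. {\<nu> \<in> P2. W2 \<mu> \<nu> < r} \<subseteq> S \<inter> T"
      by (intro exI[of _ "min r s"]) auto
  qed
  moreover have "?L (\<Union>F)" if F: "\<forall>S\<in>F. ?L S" for F
  proof (intro conjI ballI)
    show "\<Union>F \<subseteq> P2"
      using F by blast
    fix \<mu> assume "\<mu> \<in> \<Union>F"
    then obtain S where S: "S \<in> F" "\<mu> \<in> S"
      by blast
    then obtain r where "r > 0" "{\<nu> \<in> P2. W2 \<mu> \<nu> < r} \<subseteq> S"
      using F by blast
    then show "\<exists>r>0. {\<nu> \<in> P2. W2 \<mu> \<nu> < r} \<subseteq> \<Union>F"
      using S by blast
  qed
  ultimately have "istopology ?L"
    unfolding istopology_def by presburger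
  then show ?thesis
    unfolding W2_topology_def by (simp add: topology_inverse')
qed

lemma topspace_W2_topology [simp]: "topspace W2_topology = P2"
proof -
  have "openin W2_topology P2"
    unfolding openin_W2_topology using zero_less_one by blast
  moreover have "U \<subseteq> P2" if "openin W2_topology U" for U :: "'a measure set"
    using that by (simp add: openin_W2_topology)
  ultimately show ?thesis
    by (metis openin_subset openin_topspace subset_antisym)
qed

lemma W2_topology_eq_mtopology:
  assumes "Metric_space (P2 :: 'h::real_normed_vector measure set) W2"
  shows "(W2_topology :: 'h measure topology) = Metric_space.mtopology P2 W2"
proof -
  interpret Metric_space "P2 :: 'h measure set" W2 by (rule assms)
  show ?thesis
    unfolding topology_eq openin_W2_topology openin_mtopology
  proof (intro allI conj_cong refl)
    fix U :: "'h measure set"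
    assume "U \<subseteq> P2"
    then have "mball \<mu> r = {\<nu> \<in> P2. W2 \<mu> \<nu> < r}" if "\<mu> \<in> U" for \<mu> r
      using that by (auto simp: mball_def)
    then show "(\<forall>\<mu>\<in>U. \<exists>r>0. {\<nu> \<in> P2. W2 \<mu> \<nu> < r} \<subseteq> U) \<longleftrightarrow>
        (\<forall>x. x \<in> U \<longrightarrow> (\<exists>r>0. mball x r \<subseteq> U))"
      by auto
  qed
qed

definition geodesically_convex :: "'h::real_normed_vector measure set \<Rightarrow> bool" where
  "geodesically_convex K \<longleftrightarrow> K \<subseteq> P2 \<and>
     (\<forall>\<mu>\<^sub>0\<in>K. \<forall>\<mu>\<^sub>1\<in>K. \<exists>\<gamma>\<in>optimal_couplings \<mu>\<^sub>0 \<mu>\<^sub>1. \<forall>t\<in>{0..1}.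
        distr \<gamma> borel (\<lambda>(x\<^sub>0, x\<^sub>1). (1 - t) *\<^sub>R x\<^sub>0 + t *\<^sub>R x\<^sub>1) \<in> K)"


subsection \<open>Weak topologies on measures\<close>

text \<open>Narrow convergence of Borel probability measures on the space endowed with its weak topology.
  In the separable Hilbert case the weak and the norm topology have the same Borel sets, as shown
  below, so the limit can be taken in \<^const>\<open>borel_prob\<close>.\<close>

definition weakly_narrowly_converges ::
    "(nat \<Rightarrow> 'h::real_normed_vector measure) \<Rightarrow> 'h measure \<Rightarrow> bool" where
  "weakly_narrowly_converges \<mu>s \<mu> \<longleftrightarrow>
     (\<forall>f. continuous_map weak_topology euclideanreal f \<and> bounded (range f) \<longrightarrow>
        (\<lambda>n. \<integral>x. f x \<partial>\<mu>s n) \<longlonglongrightarrow> (\<integral>x. f x \<partial>\<mu>))"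

lemma sets_borel_eq_weak_borel:
  "sets (borel :: 'h::{real_inner, polish_space} measure) =
     sigma_sets UNIV {U. openin weak_topology U}" (is "_ = ?W")
proof
  show "?W \<subseteq> sets borel"
    unfolding borel_def
    by (subst sets_measure_of, simp, intro sigma_sets_mono')
       (auto intro: openin_weak_topology_imp_open)
next
  interpret W: sigma_algebra UNIV ?W
    by (rule sigma_algebra_sigma_sets) auto
  have cball: "cball x r \<in> ?W" for x :: 'h and r
  proof (cases "r < 0")
    case True
    then show ?thesis by auto
  next
    case False
    have "- cball x r = \<Union> ((\<lambda>v. {y. r * norm v + x \<bullet> v < y \<bullet> v}) ` UNIV)"
    proof (intro set_eqI iffI)
      fix y assume "y \<in> - cball x r"
      then have "r < norm (y - x)"
        by (simp add: dist_norm norm_minus_commute)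
      then have "r * norm (y - x) < norm (y - x) * norm (y - x)"
        using False by (intro mult_strict_right_mono) auto
      then have "r * norm (y - x) < (y - x) \<bullet> (y - x)"
        by (simp add: dot_square_norm power2_eq_square)
      then have "y \<in> {z. r * norm (y - x) + x \<bullet> (y - x) < z \<bullet> (y - x)}"
        by (simp add: inner_diff_left)
      then show "y \<in> (\<Union>v. {y. r * norm v + x \<bullet> v < y \<bullet> v})"
        by blast
    next
      fix y assume "y \<in> (\<Union>v. {y. r * norm v + x \<bullet> v < y \<bullet> v})"
      then obtain v where "r * norm v + x \<bullet> v < y \<bullet> v"
        by auto
      then have "r * norm v < (y - x) \<bullet> v"
        by (simp add: inner_diff_left)
      also have "\<dots> \<le> norm (y - x) * norm v"
        by (rule norm_cauchy_schwarz)
      finally have "r < norm (y - x)"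
        by (rule mult_right_less_imp_less) simp
      then show "y \<in> - cball x r"
        by (simp add: dist_norm norm_minus_commute)
    qed
    also have "openin weak_topology \<dots>"
      by (intro openin_Union) (auto intro: openin_weak_topology_halfspace)
    finally have "- cball x r \<in> ?W"
      by auto
    then show ?thesis
      using W.compl_sets[of "- cball x r"] by (simp add: Compl_eq_Diff_UNIV Diff_Diff_Int)
  qed
  have ball: "ball x r \<in> ?W" for x :: 'h and r
  proof -
    have "ball x r = (\<Union>n::nat. cball x (r - inverse (real (Suc n))))"
    proof (intro set_eqI iffI)
      fix y assume "y \<in> ball x r"
      then have "0 < r - dist x y" by simp
      then obtain n where "inverse (real (Suc n)) < r - dist x y"
        using reals_Archimedean by blast
      then show "y \<in> (\<Union>n::nat. cball x (r - inverse (real (Suc n))))"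
        by (intro UN_I[of n]) auto
    next
      fix y assume "y \<in> (\<Union>n::nat. cball x (r - inverse (real (Suc n))))"
      then obtain n where "dist x y \<le> r - inverse (real (Suc n))" by auto
      moreover have "0 < inverse (real (Suc n))" by simp
      ultimately have "dist x y < r" by linarith
      then show "y \<in> ball x r" by simp
    qed
    then show ?thesis using cball by auto
  qed
  have "U \<in> ?W" if "open U" for U :: "'h set"
  proof -
    let ?F = "{ball x r | x r. ball x r \<subseteq> U}"
    obtain F' where F': "F' \<subseteq> ?F" "countable F'" "\<Union>F' = \<Union>?F"
      by (rule Lindelof[of ?F]) auto
    have "\<Union>?F = U"
    proof
      show "U \<subseteq> \<Union>?F"
      proof
        fix x assume "x \<in> U"
        then obtain e where "e > 0" "ball x e \<subseteq> U"
          using \<open>open U\<close> open_contains_ball by blast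
        then show "x \<in> \<Union>?F"
          by (intro UnionI[of "ball x e"]) auto
      qed
    qed blast
    moreover have "F' \<subseteq> ?W"
      using F'(1) ball by blast
    then have "\<Union>F' \<in> ?W"
      using F'(2) by (rule W.countable_Union[rotated])
    ultimately show ?thesis
      using F'(3) by simp
  qed
  then show "sets borel \<subseteq> ?W"
    unfolding borel_def by (subst sets_measure_of, simp, intro W.sigma_sets_subset) auto
qed

definition P2w_topology :: "'h::real_normed_vector measure topology" where
  "P2w_topology = topology_generated_by
     {{\<mu> \<in> P2. (\<integral>x. \<zeta> x \<partial>\<mu>) \<in> U} | (\<zeta> :: 'h \<Rightarrow> real) U.
        seq_weakly_continuous \<zeta> \<and> ((\<lambda>x. \<zeta> x / (1 + (norm x)\<^sup>2)) \<longlongrightarrow> 0) at_infinity \<and> open U}"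

lemma topspace_P2w_topology [simp]: "topspace P2w_topology = P2"
proof -
  let ?z = "\<lambda>_::'a. 0::real"
  have "seq_weakly_continuous ?z \<and> ((\<lambda>x. ?z x / (1 + (norm x)\<^sup>2)) \<longlongrightarrow> 0) at_infinity"
    by (simp add: seq_weakly_continuous_def)
  then have "{\<mu> \<in> P2. (\<integral>x. ?z x \<partial>\<mu>) \<in> UNIV} \<subseteq> topspace P2w_topology"
    unfolding P2w_topology_def topology_generated_by_topspace using open_UNIV by blast
  moreover have "topspace P2w_topology \<subseteq> (P2 :: 'a measure set)"
    unfolding P2w_topology_def topology_generated_by_topspace by blast
  ultimately show ?thesis
    by auto
qed

definition sequentially_closedin :: "'a topology \<Rightarrow> 'a set \<Rightarrow> bool" where
  "sequentially_closedin X S \<longleftrightarrow> S \<subseteq> topspace X \<and>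
     (\<forall>xs x. (\<forall>n. xs n \<in> S) \<and> limitin X xs x sequentially \<longrightarrow> x \<in> S)"

end

theory Submission
  imports Defs
begin

text \<open>Suppose \<open>\<mu>\<^sub>n \<in> K\<close> converges weakly to \<open>\<mu> \<notin> K\<close>, let \<open>D > 0\<close> be the infimum of \<open>W2\<^sup>2 \<mu> \<nu>\<close>
  over \<open>\<nu> \<in> K\<close>, and choose \<open>\<nu> \<in> K\<close> almost attaining it. Couple \<open>\<mu>\<^sub>n \<sim> Z\<close> with \<open>\<mu> \<sim> X\<close> so that
  \<open>E \<bar>v \<bullet> (Z - X)\<bar>\<close> is small for finitely many vectors \<open>v\<close>, and glue this to the optimal plan
  \<open>(Y, Z)\<close> between \<open>\<nu>\<close> and \<open>\<mu>\<^sub>n\<close>. Since the law of \<open>Y\<close> does not depend on \<open>n\<close>,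
  \<open>E (Y \<bullet> (Z - X)) \<rightarrow> 0\<close>; with the optimality of \<open>(Y, Z)\<close> this makes \<open>(Y, X)\<close> asymptotically
  optimal, and
  \<open>E (norm ((1 - t) Y + t Z - X))\<^sup>2 \<le> (1 - t)\<^sup>2 E (norm (Y - X))\<^sup>2 + O(t\<^sup>2) + o(1)\<close>,
  which is below \<open>D\<close> for small \<open>t\<close>, although \<open>(1 - t) Y + t Z\<close> has its law in \<open>K\<close>. The coupling of
  \<open>\<mu>\<^sub>n\<close> with \<open>\<mu>\<close> is given by a density with respect to the product measure, so no disintegration
  is needed for gluing. For \<open>P2w_topology\<close> the bound on the second moments is proved by a gliding
  hump.\<close>

subsection \<open>Couplings with a density and gluing\<close>

text \<open>The family \<open>w\<close> plays the role of a partition into cells: as much mass as possible stays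
  in its cell, and the rest is coupled independently.
  The factor \<open>1 - e\<close> keeps the remaining mass \<open>r\<close> away from \<open>0\<close>, and
  cells of mass \<open>0\<close> get \<open>l c = 0\<close> from division by zero.\<close>

lemma coupling_density_exists:
  fixes P Q :: "'a::second_countable_topology measure" and w :: "'i \<Rightarrow> 'a \<Rightarrow> real"
  assumes "prob_space P" "prob_space Q"
    and sP [measurable_cong]: "sets P = sets borel" and sQ [measurable_cong]: "sets Q = sets borel"
    and fin: "finite I" and w [measurable]: "\<And>c. w c \<in> borel_measurable borel"
    and w0: "\<And>c x. 0 \<le> w c x" and w1: "\<And>x. (\<Sum>c\<in>I. w c x) \<le> 1"
    and e: "0 < e" "e < 1"
  obtains h :: "'a \<times> 'a \<Rightarrow> real"
  where "h \<in> borel_measurable borel" "\<And>p. 0 \<le> h p"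
    and "\<And>z. (\<integral>\<^sup>+x. ennreal (h (z, x)) \<partial>Q) = 1" "\<And>x. (\<integral>\<^sup>+z. ennreal (h (z, x)) \<partial>P) = 1"
    and "(\<integral>\<^sup>+p. ennreal (h p) * indicator {(z, x). \<forall>c\<in>I. w c z * w c x = 0} p \<partial>(P \<Otimes>\<^sub>M Q))
      \<le> ennreal (1 - (1 - e) * (\<Sum>c\<in>I. min (\<integral>x. w c x \<partial>P) (\<integral>x. w c x \<partial>Q)))"
proof -
  interpret P: prob_space P by fact
  interpret Q: prob_space Q by fact
  interpret PQ: pair_prob_space P Q ..
  have spP: "space P = UNIV" and spQ: "space Q = UNIV"
    using sP sQ by (simp_all add: sets_eq_imp_space_eq)
  define a where "a c = (\<integral>x. w c x \<partial>P)" for c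
  define b where "b c = (\<integral>x. w c x \<partial>Q)" for c
  define l where "l c = (1 - e) * min (a c) (b c) / (a c * b c)" for c
  define A where "A z = 1 - (\<Sum>c\<in>I. l c * b c * w c z)" for z
  define B where "B x = 1 - (\<Sum>c\<in>I. l c * a c * w c x)" for x
  define r where "r = 1 - (1 - e) * (\<Sum>c\<in>I. min (a c) (b c))"
  \<comment> \<open>The sum couples the measures inside the cells and has marginal densities
    \<open>1 - A\<close> and \<open>1 - B\<close>. The deficits \<open>A\<close> and
    \<open>B\<close> both have mass \<open>r\<close>, so adding their product divided by
    \<open>r\<close> restores both marginal densities to 1.\<close>
  define h where "h = (\<lambda>(z, x). (\<Sum>c\<in>I. l c * w c z * w c x) + A z * B x / r)"
  have wle: "w c x \<le> 1" if "c \<in> I" for c x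
    using member_le_sum[of c I "\<lambda>c. w c x"] that fin w0 w1[of x] by (meson Diff_iff order_trans)
  have iP: "integrable P (w c)" if "c \<in> I" for c
    by (rule P.integrable_const_bound[where B=1]) (use wle[OF that] w0 in auto)
  have iQ: "integrable Q (w c)" if "c \<in> I" for c
    by (rule Q.integrable_const_bound[where B=1]) (use wle[OF that] w0 in auto)
  have a0: "0 \<le> a c" and b0: "0 \<le> b c" for c
    by (auto simp: a_def b_def w0)
  have l0: "0 \<le> l c" for c
    using a0 b0 e by (auto simp: l_def)
  have lb: "l c * b c \<le> 1 - e" for c
  proof (cases "a c = 0 \<or> b c = 0")
    case False
    then have "a c > 0" using a0[of c] by auto
    have "l c * b c = (1 - e) * (min (a c) (b c) / a c)" using False by (simp add: l_def)
    also have "\<dots> \<le> (1 - e) * 1"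
      by (intro mult_left_mono) (use \<open>a c > 0\<close> e in auto)
    finally show ?thesis by simp
  qed (use e in \<open>auto simp: l_def\<close>)
  have la: "l c * a c \<le> 1 - e" for c
  proof (cases "a c = 0 \<or> b c = 0")
    case False
    then have "b c > 0" using b0[of c] by auto
    have "l c * a c = (1 - e) * (min (a c) (b c) / b c)" using False by (simp add: l_def)
    also have "\<dots> \<le> (1 - e) * 1"
      by (intro mult_left_mono) (use \<open>b c > 0\<close> e in auto)
    finally show ?thesis by simp
  qed (use e in \<open>auto simp: l_def\<close>)
  have lab: "l c * a c * b c = (1 - e) * min (a c) (b c)" for c
    using a0[of c] b0[of c] by (auto simp: l_def)
  have Age: "e \<le> A z" for z
  proof -
    have "(\<Sum>c\<in>I. l c * b c * w c z) \<le> (\<Sum>c\<in>I. (1 - e) * w c z)"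
      by (intro sum_mono mult_right_mono lb w0)
    also have "\<dots> \<le> (1 - e) * 1"
      unfolding sum_distrib_left[symmetric] by (intro mult_left_mono w1) (use e in auto)
    finally show ?thesis by (simp add: A_def)
  qed
  have Bge: "e \<le> B z" for z
  proof -
    have "(\<Sum>c\<in>I. l c * a c * w c z) \<le> (\<Sum>c\<in>I. (1 - e) * w c z)"
      by (intro sum_mono mult_right_mono la w0)
    also have "\<dots> \<le> (1 - e) * 1"
      unfolding sum_distrib_left[symmetric] by (intro mult_left_mono w1) (use e in auto)
    finally show ?thesis by (simp add: B_def)
  qed
  have iA: "integrable P A" and intA: "(\<integral>z. A z \<partial>P) = r"
    unfolding A_def using iP
    by (auto simp: Bochner_Integration.integral_diff Bochner_Integration.integral_sum P.prob_space
        a_def[symmetric] r_def sum_distrib_left lab[symmetric] mult_ac intro!: Bochner_Integration.integrable_diff Bochner_Integration.integrable_sum)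
  have iB: "integrable Q B" and intB: "(\<integral>z. B z \<partial>Q) = r"
    unfolding B_def using iQ
    by (auto simp: Bochner_Integration.integral_diff Bochner_Integration.integral_sum Q.prob_space
        b_def[symmetric] r_def sum_distrib_left lab[symmetric] mult_ac intro!: Bochner_Integration.integrable_diff Bochner_Integration.integrable_sum)
  have "e \<le> r"
    using integral_mono[of P "\<lambda>_. e" A] iA Age intA by (simp add: P.prob_space)
  then have r: "r > 0" using e by simp
  have A0: "0 \<le> A z" and B0: "0 \<le> B z" for z
    using Age[of z] Bge[of z] e by linarith+
  have [measurable]: "A \<in> borel_measurable borel" "B \<in> borel_measurable borel"
    unfolding A_def B_def by measurable
  have h0: "0 \<le> h p" for p
    using l0 w0 A0 B0 r by (auto simp: h_def split: prod.split intro!: add_nonneg_nonneg sum_nonneg)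
  have hm: "h \<in> borel_measurable borel"
    unfolding h_def borel_prod[symmetric] by measurable
  show ?thesis
  proof (rule that[OF hm h0])
    fix z
    have eq: "(\<lambda>x. h (z, x)) = (\<lambda>x. (\<Sum>c\<in>I. (l c * w c z) * w c x) + (A z / r) * B x)"
      by (simp add: h_def)
    have i: "integrable Q (\<lambda>x. h (z, x))"
      unfolding eq using iQ iB by (intro Bochner_Integration.integrable_add Bochner_Integration.integrable_sum integrable_mult_right) auto
    have "(\<integral>x. h (z, x) \<partial>Q) = (\<Sum>c\<in>I. (l c * w c z) * b c) + (A z / r) * r"
      unfolding eq using iQ iB
      by (subst Bochner_Integration.integral_add)
        (auto simp: Bochner_Integration.integral_sum b_def[symmetric] intB
          intro!: Bochner_Integration.integrable_sum)
    also have "\<dots> = 1"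
      using r by (simp add: A_def mult_ac)
    finally show "(\<integral>\<^sup>+x. ennreal (h (z, x)) \<partial>Q) = 1"
      using nn_integral_eq_integral[OF i] h0 by simp
  next
    fix x
    have eq: "(\<lambda>z. h (z, x)) = (\<lambda>z. (\<Sum>c\<in>I. (l c * w c x) * w c z) + (B x / r) * A z)"
      by (simp add: h_def mult_ac)
    have i: "integrable P (\<lambda>z. h (z, x))"
      unfolding eq using iP iA by (intro Bochner_Integration.integrable_add Bochner_Integration.integrable_sum integrable_mult_right) auto
    have "(\<integral>z. h (z, x) \<partial>P) = (\<Sum>c\<in>I. (l c * w c x) * a c) + (B x / r) * r"
      unfolding eq using iP iA
      by (subst Bochner_Integration.integral_add)
        (auto simp: Bochner_Integration.integral_sum a_def[symmetric] intA
          intro!: Bochner_Integration.integrable_sum)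
    also have "\<dots> = 1"
      using r by (simp add: B_def mult_ac)
    finally show "(\<integral>\<^sup>+z. ennreal (h (z, x)) \<partial>P) = 1"
      using nn_integral_eq_integral[OF i] h0 by simp
  next
    have "(\<integral>\<^sup>+p. ennreal (h p) * indicator {(z, x). \<forall>c\<in>I. w c z * w c x = 0} p \<partial>(P \<Otimes>\<^sub>M Q))
      \<le> (\<integral>\<^sup>+p. ennreal (A (fst p)) * ennreal (B (snd p) / r) \<partial>(P \<Otimes>\<^sub>M Q))"
    proof (rule nn_integral_mono)
      fix p
      \<comment> \<open>Where all the products of cell weights vanish, only the independent part of
        \<open>h\<close> is left; its total mass is \<open>r\<close>.\<close>
      show "ennreal (h p) * indicator {(z, x). \<forall>c\<in>I. w c z * w c x = 0} p
        \<le> ennreal (A (fst p)) * ennreal (B (snd p) / r)"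
        using A0 B0 r
        by (cases p) (auto simp: h_def mult.assoc ennreal_mult[symmetric] intro!: sum_nonpos
            split: split_indicator)
    qed
    also have "\<dots> = (\<integral>\<^sup>+z. (\<integral>\<^sup>+x. ennreal (A z) * ennreal (B x / r) \<partial>Q) \<partial>P)"
      by (subst Q.nn_integral_fst[symmetric]) auto
    also have "\<dots> = (\<integral>\<^sup>+z. ennreal (A z) * (\<integral>\<^sup>+x. ennreal (B x / r) \<partial>Q) \<partial>P)"
      by (intro nn_integral_cong nn_integral_cmult) measurable
    also have "(\<integral>\<^sup>+x. ennreal (B x / r) \<partial>Q) = 1"
      by (subst nn_integral_eq_integral) (use iB B0 r intB in auto)
    also have "(\<integral>\<^sup>+z. ennreal (A z) * 1 \<partial>P) = ennreal r"
      using nn_integral_eq_integral[OF iA] A0 intA by simp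
    finally show "(\<integral>\<^sup>+p. ennreal (h p) * indicator {(z, x). \<forall>c\<in>I. w c z * w c x = 0} p \<partial>(P \<Otimes>\<^sub>M Q))
      \<le> ennreal (1 - (1 - e) * (\<Sum>c\<in>I. min (\<integral>x. w c x \<partial>P) (\<integral>x. w c x \<partial>Q)))"
      by (simp add: r_def a_def b_def)
  qed
qed

text \<open>Given the second coordinate \<open>z\<close> of \<gamma>, a third coordinate is drawn
  with density \<open>h (z, _)\<close> with respect to \<open>Q\<close>, conditionally independent
  of the first. Thus \<open>hQ\<close> keeps \<gamma> as the law of the first pair,
  \<open>hP\<close> makes \<open>Q\<close> the law of the new coordinate, and the last two
  coordinates have joint density \<open>h\<close>.\<close>

lemma gluing:
  fixes \<gamma> :: "('a::second_countable_topology \<times> 'b::second_countable_topology) measure"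
    and Q :: "'c::second_countable_topology measure"
  assumes "\<gamma> \<in> borel_prob" "Q \<in> borel_prob"
    and [measurable]: "h \<in> borel_measurable borel"
    and hQ: "\<And>z. (\<integral>\<^sup>+x. h (z, x) \<partial>Q) = (1::ennreal)"
    and hP: "\<And>x. (\<integral>\<^sup>+z. h (z, x) \<partial>(distr \<gamma> borel snd)) = 1"
  defines "\<sigma> \<equiv> density (\<gamma> \<Otimes>\<^sub>M Q) (\<lambda>p. h (snd (fst p), snd p))"
  shows "\<sigma> \<in> borel_prob" "distr \<sigma> borel fst = \<gamma>" "distr \<sigma> borel snd = Q"
    and "\<And>f. f \<in> borel_measurable borel \<Longrightarrow>
      (\<integral>\<^sup>+p. f (snd (fst p), snd p) \<partial>\<sigma>) = (\<integral>\<^sup>+p. h p * f p \<partial>(distr \<gamma> borel snd \<Otimes>\<^sub>M Q))"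
proof -
  \<comment> \<open>By second countability the Borel sets of a product form the product
    sigma-algebra; \<open>borel_prod\<close> passes between the two forms here and below.\<close>
  have s\<gamma> [measurable_cong]: "sets \<gamma> = sets (borel \<Otimes>\<^sub>M borel)"
    and sQ [measurable_cong]: "sets Q = sets borel" and "prob_space \<gamma>" "prob_space Q"
    using assms(1,2) by (auto simp only: borel_prob_def mem_Collect_eq borel_prod)
  interpret G: prob_space \<gamma> by fact
  interpret Q: prob_space Q by fact
  interpret pair_sigma_finite \<gamma> Q ..
  interpret P: prob_space "distr \<gamma> borel snd" by (rule G.prob_space_distr) measurable
  have hm [measurable]: "h \<in> borel_measurable (borel \<Otimes>\<^sub>M borel)"
    by (simp add: borel_prod)
  have s\<sigma>: "sets \<sigma> = sets ((borel \<Otimes>\<^sub>M borel) \<Otimes>\<^sub>M borel)"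
    unfolding \<sigma>_def sets_density by (rule sets_pair_measure_cong[OF s\<gamma> sQ])
  have s\<sigma>': "sets \<sigma> = sets borel"
    unfolding s\<sigma> borel_prod ..
  have int: "(\<integral>\<^sup>+p. f p \<partial>\<sigma>) = (\<integral>\<^sup>+p. (\<integral>\<^sup>+x. h (snd p, x) * f (p, x) \<partial>Q) \<partial>\<gamma>)"
    if [measurable]: "f \<in> borel_measurable ((borel \<Otimes>\<^sub>M borel) \<Otimes>\<^sub>M borel)" for f
    unfolding \<sigma>_def
    by (subst nn_integral_density, measurable) (subst Q.nn_integral_fst[symmetric], auto)
  show d1: "distr \<sigma> borel fst = \<gamma>"
  proof (rule measure_eqI)
    show "sets (distr \<sigma> borel fst) = sets \<gamma>" by (simp only: s\<gamma> sets_distr borel_prod)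
    fix X assume "X \<in> sets (distr \<sigma> borel fst)"
    then have [measurable]: "X \<in> sets (borel \<Otimes>\<^sub>M borel)" by (simp only: sets_distr borel_prod)
    then have X: "X \<in> sets borel" by (simp only: borel_prod)
    have fm: "fst \<in> measurable \<sigma> borel"
      unfolding measurable_cong_sets[OF s\<sigma> refl] borel_prod[symmetric] by measurable
    have "emeasure (distr \<sigma> borel fst) X = (\<integral>\<^sup>+p. indicator X p \<partial>(distr \<sigma> borel fst))"
      using X by (subst nn_integral_indicator) auto
    also have "\<dots> = (\<integral>\<^sup>+p. indicator X (fst p) \<partial>\<sigma>)"
      using X by (subst nn_integral_distr[OF fm]) auto
    also have "\<dots> = (\<integral>\<^sup>+p. (\<integral>\<^sup>+x. h (snd p, x) * indicator X p \<partial>Q) \<partial>\<gamma>)"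
      by (subst int) auto
    also have "\<dots> = (\<integral>\<^sup>+p. (\<integral>\<^sup>+x. h (snd p, x) \<partial>Q) * indicator X p \<partial>\<gamma>)"
      by (intro nn_integral_cong nn_integral_multc) measurable
    also have "\<dots> = emeasure \<gamma> X"
      using s\<gamma> by (simp add: hQ)
    finally show "emeasure (distr \<sigma> borel fst) X = emeasure \<gamma> X" .
  qed
  show "distr \<sigma> borel snd = Q"
  proof (rule measure_eqI)
    show "sets (distr \<sigma> borel snd) = sets Q" using sQ by simp
    fix X assume "X \<in> sets (distr \<sigma> borel snd)"
    then have [measurable]: "X \<in> sets borel" by simp
    have fm: "snd \<in> measurable \<sigma> borel"
      unfolding measurable_cong_sets[OF s\<sigma> refl] by measurable
    have "emeasure (distr \<sigma> borel snd) X = (\<integral>\<^sup>+p. indicator X p \<partial>(distr \<sigma> borel snd))"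
      by (subst nn_integral_indicator) auto
    also have "\<dots> = (\<integral>\<^sup>+p. indicator X (snd p) \<partial>\<sigma>)"
      by (subst nn_integral_distr) (auto simp: fm)
    also have "\<dots> = (\<integral>\<^sup>+p. (\<integral>\<^sup>+x. h (snd p, x) * indicator X x \<partial>Q) \<partial>\<gamma>)"
      by (subst int) auto
    \<comment> \<open>The order is exchanged so that \<open>z\<close> is integrated first for fixed
      \<open>x\<close>, as \<open>hP\<close> requires.\<close>
    also have "\<dots> = (\<integral>\<^sup>+x. (\<integral>\<^sup>+p. h (snd p, x) * indicator X x \<partial>\<gamma>) \<partial>Q)"
      by (rule Fubini'[symmetric]) measurable
    also have "\<dots> = (\<integral>\<^sup>+x. (\<integral>\<^sup>+z. h (z, x) \<partial>(distr \<gamma> borel snd)) * indicator X x \<partial>Q)"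
      by (intro nn_integral_cong) (simp add: nn_integral_multc nn_integral_distr)
    also have "\<dots> = emeasure Q X"
      using sQ by (simp add: hP)
    finally show "emeasure (distr \<sigma> borel snd) X = emeasure Q X" .
  qed
  \<comment> \<open>Total mass 1 is inherited from the image measure \<gamma>.\<close>
  have "prob_space \<sigma>"
  proof (rule prob_space_distrD)
    show "fst \<in> measurable \<sigma> borel"
      unfolding measurable_cong_sets[OF s\<sigma> refl] borel_prod[symmetric] by measurable
    show "prob_space (distr \<sigma> borel fst)"
      unfolding d1 by fact
  qed
  then show "\<sigma> \<in> borel_prob" using s\<sigma>' by (simp add: borel_prob_def)
  fix f :: "'b \<times> 'c \<Rightarrow> ennreal" assume "f \<in> borel_measurable borel"
  then have [measurable]: "f \<in> borel_measurable (borel \<Otimes>\<^sub>M borel)" by (simp add: borel_prod)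
  have "(\<integral>\<^sup>+p. f (snd (fst p), snd p) \<partial>\<sigma>) = (\<integral>\<^sup>+p. (\<integral>\<^sup>+x. h (snd p, x) * f (snd p, x) \<partial>Q) \<partial>\<gamma>)"
    by (subst int) auto
  also have "\<dots> = (\<integral>\<^sup>+z. (\<integral>\<^sup>+x. h (z, x) * f (z, x) \<partial>Q) \<partial>(distr \<gamma> borel snd))"
    by (subst nn_integral_distr) auto
  also have "\<dots> = (\<integral>\<^sup>+p. h p * f p \<partial>(distr \<gamma> borel snd \<Otimes>\<^sub>M Q))"
    by (subst Q.nn_integral_fst[symmetric]) auto
  finally show "(\<integral>\<^sup>+p. f (snd (fst p), snd p) \<partial>\<sigma>) = \<dots>" .
qed

subsection \<open>Couplings along weak convergence\<close>

lemma continuous_map_weak_inner: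
  "continuous_map weak_topology euclideanreal (\<lambda>x::'h::real_inner. x \<bullet> v)"
  unfolding continuous_map_def
proof (intro conjI allI impI)
  fix U :: "real set" assume "openin euclidean U"
  then have "openin weak_topology ((\<lambda>x::'h. x \<bullet> v) -` U)"
    unfolding weak_topology_def
    by (intro topology_generated_by_Basis) (use bounded_linear_inner_left in auto)
  then show "openin weak_topology {x \<in> topspace weak_topology. (x::'h) \<bullet> v \<in> U}"
    by (simp add: vimage_def)
qed auto

lemma weakly_continuous_imp_continuous:
  fixes f :: "'h::real_normed_vector \<Rightarrow> real"
  assumes "continuous_map weak_topology euclideanreal f"
  shows "continuous_on UNIV f"
  unfolding continuous_on_open_vimage[OF open_UNIV]
proof (intro allI impI)
  fix U :: "real set" assume "open U"
  with assms have "openin weak_topology (f -` U)"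
    by (auto simp: continuous_map_def vimage_def)
  then show "open (f -` U \<inter> UNIV)"
    using openin_weak_topology_imp_open by auto
qed

lemma weakly_continuous_imp_borel_measurable:
  assumes "continuous_map weak_topology euclideanreal f"
  shows "f \<in> borel_measurable borel"
  by (intro borel_measurable_continuous_onI weakly_continuous_imp_continuous assms)

lemma sum_abs_inner_le:
  fixes x :: "'h::real_inner"
  shows "(\<Sum>v\<in>V. \<bar>x \<bullet> v\<bar>) \<le> (\<Sum>v\<in>V. norm v) * norm x"
  unfolding sum_distrib_right
  by (intro sum_mono) (metis Cauchy_Schwarz_ineq2 mult.commute)

text \<open>Cells of small diameter for the seminorm given by \<open>V\<close> are placed around a
  dense sequence, and each \<open>w c\<close> is what the earlier bumps leave of the bump
  \<open>u c\<close>. The partial sums reach 1 at every point, so dominated convergence leaves less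
  than \<open>e\<close> of the mass of \<mu> outside finitely many cells. Weakly continuous weights,
  unlike indicators, have integrals that pass to narrow limits.\<close>

lemma weak_partition_of_unity:
  fixes \<mu> :: "'h::{real_inner, polish_space} measure"
  assumes mu: "\<mu> \<in> borel_prob" and V: "finite V" and d: "0 < d" and e: "0 < e"
  obtains w :: "nat \<Rightarrow> 'h \<Rightarrow> real" and M :: nat
  where "\<And>c. continuous_map weak_topology euclideanreal (w c)" "\<And>c x. 0 \<le> w c x"
    and "\<And>x. (\<Sum>c<M. w c x) \<le> 1"
    and "\<And>c x z. w c z * w c x \<noteq> 0 \<Longrightarrow> (\<Sum>v\<in>V. \<bar>(z - x) \<bullet> v\<bar>) \<le> 4 * d"
    and "1 - e < (\<Sum>c<M. \<integral>x. w c x \<partial>\<mu>)"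
proof -
  have "prob_space \<mu>" and s\<mu> [measurable_cong]: "sets \<mu> = sets borel"
    using mu by (auto simp: borel_prob_def)
  interpret prob_space \<mu> by fact
  obtain D :: "'h set" where D: "countable D" "\<And>X. open X \<Longrightarrow> X \<noteq> {} \<Longrightarrow> \<exists>d\<in>D. d \<in> X"
    by (rule countable_dense_setE) blast
  have "D \<noteq> {}" using D(2)[of UNIV] by auto
  define q where "q = from_nat_into D"
  have rq: "range q = D"
    using range_from_nat_into[OF \<open>D \<noteq> {}\<close> D(1)] by (simp add: q_def)
  define \<rho> where "\<rho> x = (\<Sum>v\<in>V. \<bar>x \<bullet> v\<bar>)" for x :: 'h
  \<comment> \<open>\<open>u i\<close> is 1 where the seminorm distance to \<open>q i\<close> is at
    most \<open>d\<close> and 0 from \<open>2 * d\<close> on, so two points in the support of one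
    cell are at distance at most \<open>4 * d\<close>.\<close>
  define u where "u i x = max 0 (min 1 (2 - \<rho> (x - q i) / d))" for i x
  define w where "w c x = u c x * (\<Prod>k<c. 1 - u k x)" for c x
  have u01: "0 \<le> u i x" "u i x \<le> 1" for i x by (auto simp: u_def)
  \<comment> \<open>The sum telescopes, and it equals 1 as soon as one factor
    \<open>1 - u k x\<close> vanishes.\<close>
  have sumw: "(\<Sum>c<M. w c x) = 1 - (\<Prod>k<M. 1 - u k x)" for M x
    by (induction M) (auto simp: w_def algebra_simps)
  have prod0: "0 \<le> (\<Prod>k<M. 1 - u k x)" for M x
    by (intro prod_nonneg) (use u01 in auto)
  have sumw1: "(\<Sum>c<M. w c x) \<le> 1" for M x
    using prod0 by (simp add: sumw)
  have w0: "0 \<le> w c x" for c x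
    using prod0 u01 by (simp add: w_def)
  have wle: "w c x \<le> 1" for c x
    using sum_mono2[of "{..<Suc c}" "{c}" "\<lambda>c. w c x"] sumw1[of x "Suc c"] w0 by simp
  have cu: "continuous_map weak_topology euclideanreal (u i)" for i
    unfolding u_def \<rho>_def inner_diff_left
    by (intro continuous_map_real_max continuous_map_real_min continuous_map_diff
        continuous_map_real_divide continuous_map_sum continuous_map_real_abs
        continuous_map_weak_inner V) (use d in auto)
  have cw: "continuous_map weak_topology euclideanreal (w c)" for c
    unfolding w_def
    by (intro continuous_map_real_mult continuous_map_prod cu continuous_map_diff) auto
  have wm [measurable]: "w c \<in> borel_measurable borel" for c
    by (rule weakly_continuous_imp_borel_measurable[OF cw])
  \<comment> \<open>Norm density suffices because the seminorm is at most \<open>R\<close> times the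
    norm. The radius uses \<open>R + 1\<close> since \<open>R\<close> may be 0.\<close>
  have ex1: "\<exists>k. u k x = 1" for x
  proof -
    define R where "R = (\<Sum>v\<in>V. norm v)"
    have "R \<ge> 0" by (simp add: R_def sum_nonneg)
    obtain y where y: "y \<in> D" "y \<in> ball x (d / (R + 1))"
    proof -
      have "0 < d / (R + 1)" using d \<open>R \<ge> 0\<close> by auto
      then show ?thesis using that D(2)[of "ball x (d / (R + 1))"] by fastforce
    qed
    obtain k where "y = q k" using y(1) rq by auto
    have "\<rho> (x - q k) \<le> R * norm (x - q k)"
      unfolding \<rho>_def R_def by (rule sum_abs_inner_le)
    also have "\<dots> \<le> R * (d / (R + 1))"
      by (intro mult_left_mono) (use y \<open>y = q k\<close> \<open>R \<ge> 0\<close> in \<open>auto simp: dist_norm\<close>)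
    also have "\<dots> \<le> d" using d \<open>R \<ge> 0\<close> by (simp add: field_simps)
    finally have "u k x = 1" using d by (simp add: u_def field_simps)
    then show ?thesis ..
  qed
  have "(\<lambda>M. \<integral>x. (\<Sum>c<M. w c x) \<partial>\<mu>) \<longlonglongrightarrow> (\<integral>x. 1 \<partial>\<mu>)"
  proof (rule integral_dominated_convergence[where w="\<lambda>_. 1"])
    show "AE x in \<mu>. (\<lambda>M. \<Sum>c<M. w c x) \<longlonglongrightarrow> 1"
    proof (rule AE_I2)
      fix x
      obtain k where k: "u k x = 1" using ex1 by blast
      have "\<forall>\<^sub>F M in sequentially. (\<Sum>c<M. w c x) = 1"
        using eventually_gt_at_top[of k]
        by eventually_elim (auto simp: sumw k intro!: prod_zero bexI[of _ k])
      then show "(\<lambda>M. \<Sum>c<M. w c x) \<longlonglongrightarrow> 1"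
        by (rule tendsto_eventually)
    qed
    show "AE x in \<mu>. norm (\<Sum>c<M. w c x) \<le> 1" for M
      using sumw1 w0 by (auto simp: abs_of_nonneg sum_nonneg)
  qed auto
  then have "(\<lambda>M. \<Sum>c<M. \<integral>x. w c x \<partial>\<mu>) \<longlonglongrightarrow> 1"
  proof (subst (asm) Bochner_Integration.integral_sum)
    show "integrable \<mu> (w c)" for c
      by (rule integrable_const_bound[where B=1]) (use wle w0 in auto)
  qed (simp add: prob_space)
  then have "\<forall>\<^sub>F M in sequentially. 1 - e < (\<Sum>c<M. \<integral>x. w c x \<partial>\<mu>)"
    by (rule order_tendstoD) (use e in simp)
  then obtain M where M: "1 - e < (\<Sum>c<M. \<integral>x. w c x \<partial>\<mu>)"
    by (auto simp: eventually_sequentially)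
  show ?thesis
  proof (rule that[OF cw w0 sumw1 _ M])
    fix c x z assume "w c z * w c x \<noteq> 0"
    then have "u c z \<noteq> 0" "u c x \<noteq> 0" by (auto simp: w_def)
    then have *: "\<rho> (z - q c) < 2 * d" "\<rho> (x - q c) < 2 * d"
      using d by (auto simp: u_def max_def min_def field_simps split: if_splits)
    have "(\<Sum>v\<in>V. \<bar>(z - x) \<bullet> v\<bar>) \<le> (\<Sum>v\<in>V. \<bar>(z - q c) \<bullet> v\<bar> + \<bar>(x - q c) \<bullet> v\<bar>)"
      by (intro sum_mono) (simp add: inner_diff_left)
    also have "\<dots> = \<rho> (z - q c) + \<rho> (x - q c)" by (simp add: \<rho>_def sum.distrib)
    finally show "(\<Sum>v\<in>V. \<bar>(z - x) \<bullet> v\<bar>) \<le> 4 * d" using * by linarith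
  qed
qed

section \<open>Couplings that are close when tested against finitely many vectors\<close>

lemma nn_integral_density_marginals:
  fixes P :: "'a::second_countable_topology measure" and Q :: "'b::second_countable_topology measure"
  assumes "P \<in> borel_prob" "Q \<in> borel_prob"
    and h: "h \<in> borel_measurable borel"
    and hQ: "\<And>z. (\<integral>\<^sup>+x. h (z, x) \<partial>Q) = (1::ennreal)"
    and hP: "\<And>x. (\<integral>\<^sup>+z. h (z, x) \<partial>P) = 1"
    and [measurable]: "f \<in> borel_measurable borel" "g \<in> borel_measurable borel"
  shows "(\<integral>\<^sup>+p. h p * f (fst p) \<partial>(P \<Otimes>\<^sub>M Q)) = (\<integral>\<^sup>+z. f z \<partial>P)"
    and "(\<integral>\<^sup>+p. h p * g (snd p) \<partial>(P \<Otimes>\<^sub>M Q)) = (\<integral>\<^sup>+x. g x \<partial>Q)"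
proof -
  have [measurable_cong]: "sets P = sets borel" "sets Q = sets borel"
    and "prob_space P" "prob_space Q"
    using assms(1,2) by (auto simp: borel_prob_def)
  interpret P: prob_space P by fact
  interpret Q: prob_space Q by fact
  interpret pair_sigma_finite P Q ..
  have [measurable]: "h \<in> borel_measurable (borel \<Otimes>\<^sub>M borel)"
    using h by (simp only: borel_prod)
  have "(\<integral>\<^sup>+p. h p * f (fst p) \<partial>(P \<Otimes>\<^sub>M Q)) = (\<integral>\<^sup>+z. (\<integral>\<^sup>+x. h (z, x) * f z \<partial>Q) \<partial>P)"
    by (subst Q.nn_integral_fst[symmetric]) auto
  also have "\<dots> = (\<integral>\<^sup>+z. f z \<partial>P)"
    by (intro nn_integral_cong) (simp add: nn_integral_multc hQ)
  finally show "(\<integral>\<^sup>+p. h p * f (fst p) \<partial>(P \<Otimes>\<^sub>M Q)) = (\<integral>\<^sup>+z. f z \<partial>P)" .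
  have "(\<integral>\<^sup>+p. h p * g (snd p) \<partial>(P \<Otimes>\<^sub>M Q)) = (\<integral>\<^sup>+x. (\<integral>\<^sup>+z. h (z, x) * g x \<partial>P) \<partial>Q)"
    by (subst nn_integral_snd[symmetric]) auto
  also have "\<dots> = (\<integral>\<^sup>+x. g x \<partial>Q)"
    by (intro nn_integral_cong) (simp add: nn_integral_multc hP)
  finally show "(\<integral>\<^sup>+p. h p * g (snd p) \<partial>(P \<Otimes>\<^sub>M Q)) = (\<integral>\<^sup>+x. g x \<partial>Q)" .
qed

text \<open>By the parallelogram law the two sides differ by
  \<open>(norm (x + y))\<^sup>2\<close>.\<close>

lemma norm_diff_squared_le:
  fixes x y :: "'a::real_inner"
  shows "(norm (x - y))\<^sup>2 \<le> 2 * (norm x)\<^sup>2 + 2 * (norm y)\<^sup>2"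
  using zero_le_power2[of "norm (x + y)"]
  by (simp only: power2_norm_eq_inner) (simp add: algebra_simps inner_commute)

text \<open>Pairs in a common cell contribute at most \<open>4 * d\<close>. The remaining pairs form
  a set \<open>G\<close> of small mass, on which Young's inequality bounds the integrand by a small
  multiple of the squared norms plus a constant \<open>k\<close>; the uniform second moments control
  the former and the mass of \<open>G\<close> the latter.\<close>

lemma eventually_weak_coupling_density:
  fixes \<mu> :: "'h::{real_inner, polish_space} measure"
  assumes mu: "\<mu> \<in> borel_prob" and mun: "\<And>n. \<mu>s n \<in> borel_prob"
    and conv: "weakly_narrowly_converges \<mu>s \<mu>"
    and B: "second_moment \<mu> \<le> ennreal B" "\<And>n. second_moment (\<mu>s n) \<le> ennreal B" "0 \<le> B"
    and V: "finite V" and e: "0 < e"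
  shows "\<forall>\<^sub>F n in sequentially. \<exists>h :: 'h \<times> 'h \<Rightarrow> ennreal. h \<in> borel_measurable borel \<and>
    (\<forall>z. (\<integral>\<^sup>+x. h (z, x) \<partial>\<mu>) = 1) \<and> (\<forall>x. (\<integral>\<^sup>+z. h (z, x) \<partial>\<mu>s n) = 1) \<and>
    (\<integral>\<^sup>+p. h p * ennreal (\<Sum>v\<in>V. \<bar>(fst p - snd p) \<bullet> v\<bar>) \<partial>(\<mu>s n \<Otimes>\<^sub>M \<mu>)) \<le> ennreal e"
proof -
  \<comment> \<open>The constants make three contributions at most \<open>e / 4\<close> each:
    \<open>4 * d\<close>, the two moment terms with sum \<open>4 * s * B\<close>, and
    \<open>3 * c * k\<close> from the exceptional set. \<open>k\<close> is the constant of Young's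
    inequality with weight \<open>s\<close>. The summands \<open>+ 1\<close> keep the denominators
    positive.\<close>
  define d where "d = e / 16"
  define R where "R = (\<Sum>v\<in>V. norm v)"
  define s where "s = e / (16 * (B + 1))"
  define k where "k = R\<^sup>2 / (4 * s)"
  define c where "c = min (1 / 2) (e / (12 * (k + 1)))"
  have R0: "0 \<le> R" by (simp add: R_def sum_nonneg)
  have pos: "0 < d" "0 < s" "0 \<le> k" using e B(3) by (auto simp: d_def s_def k_def)
  then have c: "0 < c" "c < 1" "3 * c * k \<le> e / 4"
  proof -
    show "0 < c" "c < 1" using e pos by (auto simp: c_def)
    have "3 * c * k \<le> 3 * (e / (12 * (k + 1))) * (k + 1)"
      by (intro mult_mono) (use e pos in \<open>auto simp: c_def\<close>)
    also have "\<dots> = e / 4" using pos by (simp add: field_simps)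
    finally show "3 * c * k \<le> e / 4" .
  qed
  obtain w :: "nat \<Rightarrow> 'h \<Rightarrow> real" and M where
    cw: "\<And>c. continuous_map weak_topology euclideanreal (w c)" and w0: "\<And>c x. 0 \<le> w c x"
    and w1: "\<And>x. (\<Sum>c<M. w c x) \<le> 1"
    and near: "\<And>c x z. w c z * w c x \<noteq> 0 \<Longrightarrow> (\<Sum>v\<in>V. \<bar>(z - x) \<bullet> v\<bar>) \<le> 4 * d"
    and M: "1 - c < (\<Sum>c<M. \<integral>x. w c x \<partial>\<mu>)"
    using weak_partition_of_unity[OF mu V pos(1) c(1)] by metis
  have wm [measurable]: "w c \<in> borel_measurable borel" for c
    by (rule weakly_continuous_imp_borel_measurable[OF cw])
  have "(\<lambda>n. \<integral>x. w i x \<partial>\<mu>s n) \<longlonglongrightarrow> (\<integral>x. w i x \<partial>\<mu>)" if "i < M" for i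
  proof -
    have "w i x \<le> 1" for x
      using order_trans[OF member_le_sum[of i "{..<M}" "\<lambda>c. w c x"] w1[of x]] that w0 by simp
    then have "bounded (range (w i))"
      using w0 by (intro boundedI[of _ 1]) auto
    then show ?thesis using conv cw by (auto simp: weakly_narrowly_converges_def)
  qed
  \<comment> \<open>In the limit both arguments of each \<open>min\<close> agree, so the overlap of
    the cell masses tends to the mass that \<mu> gives to the cells, which exceeds
    \<open>1 - c\<close>.\<close>
  then have "(\<lambda>n. \<Sum>i<M. min (\<integral>x. w i x \<partial>\<mu>s n) (\<integral>x. w i x \<partial>\<mu>))
      \<longlonglongrightarrow> (\<Sum>i<M. min (\<integral>x. w i x \<partial>\<mu>) (\<integral>x. w i x \<partial>\<mu>))"
    by (intro tendsto_sum tendsto_min tendsto_const) auto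
  then have "\<forall>\<^sub>F n in sequentially. 1 - c < (\<Sum>i<M. min (\<integral>x. w i x \<partial>\<mu>s n) (\<integral>x. w i x \<partial>\<mu>))"
    by (rule order_tendstoD) (use M in simp)
  then show ?thesis
  proof eventually_elim
    case (elim n)
    define G where "G = {(z, x). \<forall>c\<in>{..<M}. w c z * w c x = 0}"
    have spaces: "prob_space (\<mu>s n)" "prob_space \<mu>"
      and st [measurable_cong]: "sets (\<mu>s n) = sets borel" "sets \<mu> = sets borel"
      using mu mun by (auto simp: borel_prob_def)
    obtain h :: "'h \<times> 'h \<Rightarrow> real" where hm: "h \<in> borel_measurable borel" and h0: "\<And>p. 0 \<le> h p"
      and hx: "\<And>z. (\<integral>\<^sup>+x. ennreal (h (z, x)) \<partial>\<mu>) = 1" and hz: "\<And>x. (\<integral>\<^sup>+z. ennreal (h (z, x)) \<partial>\<mu>s n) = 1"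
      and hG: "(\<integral>\<^sup>+p. ennreal (h p) * indicator G p \<partial>(\<mu>s n \<Otimes>\<^sub>M \<mu>))
      \<le> ennreal (1 - (1 - c) * (\<Sum>i<M. min (\<integral>x. w i x \<partial>\<mu>s n) (\<integral>x. w i x \<partial>\<mu>)))"
      by (rule coupling_density_exists[OF spaces st finite_lessThan wm w0 w1 c(1,2)])
        (rule that; (assumption | simp only: G_def))
    define H where "H p = ennreal (h p)" for p
    have Hm: "H \<in> borel_measurable borel" using hm unfolding H_def by measurable
    then have Hm' [measurable]: "H \<in> borel_measurable (borel \<Otimes>\<^sub>M borel)" by (simp only: borel_prod)
    have Gm [measurable]: "G \<in> sets (borel \<Otimes>\<^sub>M borel)"
    proof -
      have "G = {p \<in> space (borel \<Otimes>\<^sub>M borel). \<forall>c\<in>{..<M}. w c (fst p) * w c (snd p) = 0}"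
        by (auto simp: G_def space_pair_measure)
      also have "\<dots> \<in> sets (borel \<Otimes>\<^sub>M borel)" by measurable
      finally show ?thesis .
    qed
    note marg = nn_integral_density_marginals[OF mun mu Hm, of n, unfolded H_def, OF hx hz, folded H_def]
    \<comment> \<open>\<open>c\<close> also serves as the loss parameter \<open>e\<close> of the
      density construction; one factor \<open>1 - c\<close> comes from that loss, the other from the
      overlap of the cell masses.\<close>
    have "1 - (1 - c) * (\<Sum>i<M. min (\<integral>x. w i x \<partial>\<mu>s n) (\<integral>x. w i x \<partial>\<mu>)) \<le> 1 - (1 - c) * (1 - c)"
      using elim c by (intro diff_left_mono mult_left_mono) auto
    also have "\<dots> \<le> 3 * c" using c by (simp add: algebra_simps)
    finally have HG: "(\<integral>\<^sup>+p. H p * indicator G p \<partial>(\<mu>s n \<Otimes>\<^sub>M \<mu>)) \<le> ennreal (3 * c)"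
      using hG unfolding H_def by (meson ennreal_leI order_trans)
    have pt: "(\<Sum>v\<in>V. \<bar>(z - x) \<bullet> v\<bar>) \<le> 4 * d + 2 * s * (norm z)\<^sup>2 + 2 * s * (norm x)\<^sup>2 + k * indicator G (z, x)"
      for z x
    proof (cases "(z, x) \<in> G")
      case False
      then obtain i where "i < M" "w i z * w i x \<noteq> 0" by (auto simp: G_def)
      from near[OF this(2)] show ?thesis
        using pos by (intro order_trans[OF near[OF \<open>w i z * w i x \<noteq> 0\<close>]]) auto
    next
      case True
      \<comment> \<open>Expanding this square and dividing by \<open>4 * s\<close> gives Young's
        inequality with the constant \<open>k\<close>.\<close>
      have "0 \<le> (2 * s * norm (z - x) - R)\<^sup>2" by simp
      then have "R * norm (z - x) \<le> s * (norm (z - x))\<^sup>2 + k"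
        using pos by (simp add: k_def power2_eq_square field_simps)
      moreover have "s * (norm (z - x))\<^sup>2 \<le> s * (2 * (norm z)\<^sup>2 + 2 * (norm x)\<^sup>2)"
        using pos by (intro mult_left_mono norm_diff_squared_le) auto
      moreover have "(\<Sum>v\<in>V. \<bar>(z - x) \<bullet> v\<bar>) \<le> R * norm (z - x)"
        unfolding R_def by (rule sum_abs_inner_le)
      ultimately show ?thesis using True pos by (simp add: algebra_simps)
    qed
    have "(\<integral>\<^sup>+p. H p * ennreal (\<Sum>v\<in>V. \<bar>(fst p - snd p) \<bullet> v\<bar>) \<partial>(\<mu>s n \<Otimes>\<^sub>M \<mu>))
      \<le> (\<integral>\<^sup>+p. H p * ennreal (4 * d) + H p * ennreal (2 * s * (norm (fst p))\<^sup>2)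
          + H p * ennreal (2 * s * (norm (snd p))\<^sup>2) + ennreal k * (H p * indicator G p) \<partial>(\<mu>s n \<Otimes>\<^sub>M \<mu>))"
    proof (rule nn_integral_mono)
      fix p
      have "H p * ennreal (\<Sum>v\<in>V. \<bar>(fst p - snd p) \<bullet> v\<bar>) \<le> H p * ennreal (4 * d + 2 * s * (norm (fst p))\<^sup>2
        + 2 * s * (norm (snd p))\<^sup>2 + k * indicator G p)"
        using pt[of "fst p" "snd p"] by (intro mult_left_mono ennreal_leI) auto
      also have "\<dots> = H p * ennreal (4 * d) + H p * ennreal (2 * s * (norm (fst p))\<^sup>2)
          + H p * ennreal (2 * s * (norm (snd p))\<^sup>2) + ennreal k * (H p * indicator G p)"
        using pos by (simp add: ennreal_plus distrib_left mult_ac split: split_indicator)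
      finally show "H p * ennreal (\<Sum>v\<in>V. \<bar>(fst p - snd p) \<bullet> v\<bar>) \<le> \<dots>" .
    qed
    also have "\<dots> = (\<integral>\<^sup>+p. H p * ennreal (4 * d) \<partial>(\<mu>s n \<Otimes>\<^sub>M \<mu>))
       + (\<integral>\<^sup>+p. H p * ennreal (2 * s * (norm (fst p))\<^sup>2) \<partial>(\<mu>s n \<Otimes>\<^sub>M \<mu>))
       + (\<integral>\<^sup>+p. H p * ennreal (2 * s * (norm (snd p))\<^sup>2) \<partial>(\<mu>s n \<Otimes>\<^sub>M \<mu>))
       + (\<integral>\<^sup>+p. ennreal k * (H p * indicator G p) \<partial>(\<mu>s n \<Otimes>\<^sub>M \<mu>))"
      by (subst nn_integral_add; measurable)+
    also have "\<dots> \<le> ennreal (4 * d) + ennreal (2 * s * B) + ennreal (2 * s * B) + ennreal (k * (3 * c))"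
    proof (intro add_mono)
      have "(\<integral>\<^sup>+p. H p * ennreal (4 * d) \<partial>(\<mu>s n \<Otimes>\<^sub>M \<mu>)) = (\<integral>\<^sup>+z. ennreal (4 * d) \<partial>\<mu>s n)"
        by (rule marg(1)) measurable
      also have "\<dots> = ennreal (4 * d)"
        using spaces(1) by (simp add: prob_space.emeasure_space_1)
      finally show "(\<integral>\<^sup>+p. H p * ennreal (4 * d) \<partial>(\<mu>s n \<Otimes>\<^sub>M \<mu>)) \<le> ennreal (4 * d)" by simp
      have "(\<integral>\<^sup>+p. H p * ennreal (2 * s * (norm (fst p))\<^sup>2) \<partial>(\<mu>s n \<Otimes>\<^sub>M \<mu>))
        = (\<integral>\<^sup>+z. ennreal (2 * s * (norm z)\<^sup>2) \<partial>\<mu>s n)"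
        by (rule marg(1)) measurable
      also have "\<dots> = ennreal (2 * s) * second_moment (\<mu>s n)"
        unfolding second_moment_def using pos by (simp add: ennreal_mult nn_integral_cmult)
      also have "\<dots> \<le> ennreal (2 * s) * ennreal B" by (intro mult_left_mono B) auto
      also have "\<dots> = ennreal (2 * s * B)" using pos B by (simp add: ennreal_mult)
      finally show "(\<integral>\<^sup>+p. H p * ennreal (2 * s * (norm (fst p))\<^sup>2) \<partial>(\<mu>s n \<Otimes>\<^sub>M \<mu>)) \<le> ennreal (2 * s * B)" .
      have "(\<integral>\<^sup>+p. H p * ennreal (2 * s * (norm (snd p))\<^sup>2) \<partial>(\<mu>s n \<Otimes>\<^sub>M \<mu>))
        = (\<integral>\<^sup>+z. ennreal (2 * s * (norm z)\<^sup>2) \<partial>\<mu>)"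
        by (rule marg(2)[of "\<lambda>_. 0"]) measurable
      also have "\<dots> = ennreal (2 * s) * second_moment \<mu>"
        unfolding second_moment_def using pos by (simp add: ennreal_mult nn_integral_cmult)
      also have "\<dots> \<le> ennreal (2 * s) * ennreal B" by (intro mult_left_mono B) auto
      also have "\<dots> = ennreal (2 * s * B)" using pos B by (simp add: ennreal_mult)
      finally show "(\<integral>\<^sup>+p. H p * ennreal (2 * s * (norm (snd p))\<^sup>2) \<partial>(\<mu>s n \<Otimes>\<^sub>M \<mu>)) \<le> ennreal (2 * s * B)" .
      have "(\<integral>\<^sup>+p. ennreal k * (H p * indicator G p) \<partial>(\<mu>s n \<Otimes>\<^sub>M \<mu>))
        = ennreal k * (\<integral>\<^sup>+p. H p * indicator G p \<partial>(\<mu>s n \<Otimes>\<^sub>M \<mu>))"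
        by (rule nn_integral_cmult) measurable
      also have "\<dots> \<le> ennreal k * ennreal (3 * c)" by (intro mult_left_mono HG) auto
      also have "\<dots> = ennreal (k * (3 * c))" using pos c by (simp add: ennreal_mult)
      finally show "(\<integral>\<^sup>+p. ennreal k * (H p * indicator G p) \<partial>(\<mu>s n \<Otimes>\<^sub>M \<mu>)) \<le> ennreal (k * (3 * c))" .
    qed
    also have "\<dots> = ennreal (4 * d + 2 * s * B + 2 * s * B + k * (3 * c))"
      using pos B c by (simp flip: ennreal_plus)
    also have "\<dots> \<le> ennreal e"
    proof (rule ennreal_leI)
      have "s * B \<le> e / 16"
        using B(3) e by (simp add: s_def field_simps)
      then show "4 * d + 2 * s * B + 2 * s * B + k * (3 * c) \<le> e"
        using c(3) e by (simp add: d_def mult_ac)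
    qed
    finally have "(\<integral>\<^sup>+p. H p * ennreal (\<Sum>v\<in>V. \<bar>(fst p - snd p) \<bullet> v\<bar>) \<partial>(\<mu>s n \<Otimes>\<^sub>M \<mu>)) \<le> ennreal e" .
    then show ?case using Hm hx hz unfolding H_def by blast
  qed
qed

section \<open>Inner products with a random vector of fixed law\<close>

lemma abs_inner_le_half:
  fixes x y :: "'a::real_inner"
  assumes "0 < e"
  shows "\<bar>x \<bullet> y\<bar> \<le> ((norm x)\<^sup>2 / e + e * (norm y)\<^sup>2) / 2"
proof -
  \<comment> \<open>Young's inequality with weight \<open>e\<close>, combined below with
    Cauchy-Schwarz.\<close>
  have "0 \<le> (norm x - e * norm y)\<^sup>2" by simp
  then have "norm x * norm y \<le> ((norm x)\<^sup>2 / e + e * (norm y)\<^sup>2) / 2"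
    using assms by (simp add: power2_eq_square field_simps)
  then show ?thesis using Cauchy_Schwarz_ineq2 order_trans by blast
qed

text \<open>Simple functions tend to the identity pointwise and stay below twice the norm, so
  dominated convergence applies. The finite range makes it possible to control inner products by
  finitely many test vectors.\<close>

lemma simple_approx_second_moment:
  fixes \<nu> :: "'h::{real_inner, polish_space} measure"
  assumes "\<nu> \<in> P2" and e: "0 < e"
  obtains s V where "s \<in> borel_measurable borel" "finite V" "range s \<subseteq> V"
    "(\<integral>\<^sup>+y. ennreal ((norm (y - s y))\<^sup>2) \<partial>\<nu>) \<le> ennreal e"
proof -
  have st [measurable_cong]: "sets \<nu> = sets borel" and fin: "second_moment \<nu> < \<infinity>"
    using assms by (auto simp: P2_def borel_prob_def)
  have sp: "space \<nu> = UNIV" using sets_eq_imp_space_eq[OF st] by simp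
  obtain F :: "nat \<Rightarrow> 'h \<Rightarrow> 'h" where F: "\<And>i. simple_function \<nu> (F i)" "\<And>x. (\<lambda>i. F i x) \<longlonglongrightarrow> x"
    "\<And>i x. norm (F i x) \<le> 2 * norm x"
    using borel_measurable_implies_sequence_metric[of "\<lambda>x. x" \<nu> 0] by (auto simp: sp)
  have Fm [measurable]: "F i \<in> borel_measurable borel" for i
    using borel_measurable_simple_function[OF F(1)[of i]] measurable_cong_sets[OF st refl] by blast
  have "(\<lambda>i. \<integral>\<^sup>+y. ennreal ((norm (y - F i y))\<^sup>2) \<partial>\<nu>) \<longlonglongrightarrow> (\<integral>\<^sup>+y. 0 \<partial>\<nu>)"
  \<comment> \<open>The factor 10 is \<open>2 + 2 * 2\<^sup>2\<close>, from the parallelogram bound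
    and \<open>norm (F i y) \<le> 2 * norm y\<close>.\<close>
  proof (rule nn_integral_dominated_convergence[where w="\<lambda>y. ennreal (10 * (norm y)\<^sup>2)"])
    show "AE y in \<nu>. ennreal ((norm (y - F i y))\<^sup>2) \<le> ennreal (10 * (norm y)\<^sup>2)" for i
    proof (intro AE_I2 ennreal_leI)
      fix y
      have "(norm (F i y))\<^sup>2 \<le> (2 * norm y)\<^sup>2" by (intro power_mono F(3)) auto
      then show "(norm (y - F i y))\<^sup>2 \<le> 10 * (norm y)\<^sup>2"
        using norm_diff_squared_le[of y "F i y"] by (simp add: power_mult_distrib)
    qed
    have "(\<integral>\<^sup>+y. ennreal (10 * (norm y)\<^sup>2) \<partial>\<nu>) = 10 * second_moment \<nu>"
      unfolding second_moment_def by (simp add: ennreal_mult nn_integral_cmult)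
    then show "(\<integral>\<^sup>+y. ennreal (10 * (norm y)\<^sup>2) \<partial>\<nu>) < \<infinity>"
      using fin by (simp add: ennreal_mult_less_top)
    show "AE y in \<nu>. (\<lambda>i. ennreal ((norm (y - F i y))\<^sup>2)) \<longlonglongrightarrow> 0"
    proof (rule AE_I2)
      fix y
      have "(\<lambda>i. ennreal ((norm (y - F i y))\<^sup>2)) \<longlonglongrightarrow> ennreal ((norm (y - y))\<^sup>2)"
        by (intro tendsto_intros F(2))
      then show "(\<lambda>i. ennreal ((norm (y - F i y))\<^sup>2)) \<longlonglongrightarrow> 0" by simp
    qed
  qed measurable
  then have "\<forall>\<^sub>F i in sequentially. (\<integral>\<^sup>+y. ennreal ((norm (y - F i y))\<^sup>2) \<partial>\<nu>) < ennreal e"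
    by (rule order_tendstoD) (use e in simp)
  then obtain i where "(\<integral>\<^sup>+y. ennreal ((norm (y - F i y))\<^sup>2) \<partial>\<nu>) \<le> ennreal e"
    by (auto simp: eventually_sequentially intro: less_imp_le)
  then show ?thesis
    using that[OF Fm, of "range (F i)" i] F(1)[of i] sp by (auto simp: simple_function_def)
qed

text \<open>Split \<open>Y\<close> into \<open>Y - s Y\<close> and \<open>s Y\<close>. Young's
  inequality with weight \<open>e\<close> bounds the first part by \<open>e + e * C\<close>, and the
  second takes values in \<open>V\<close>, so it is bounded by \<open>a\<close>. The approximation
  \<open>s\<close> depends only on the law of \<open>Y\<close>, which makes the bound uniform along
  a sequence with that law fixed.\<close>

lemma abs_integral_inner_le:
  fixes Y D :: "'a \<Rightarrow> 'h::{real_inner, polish_space}"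
  assumes [measurable]: "Y \<in> borel_measurable M" "D \<in> borel_measurable M" "s \<in> borel_measurable borel"
    and V: "finite V" "range s \<subseteq> V" and e: "0 < e" and C: "0 \<le> C" and a: "0 \<le> a"
    and s: "(\<integral>\<^sup>+y. ennreal ((norm (y - s y))\<^sup>2) \<partial>(distr M borel Y)) \<le> ennreal (e\<^sup>2)"
    and D: "(\<integral>\<^sup>+p. ennreal ((norm (D p))\<^sup>2) \<partial>M) \<le> ennreal C"
    and VD: "(\<integral>\<^sup>+p. ennreal (\<Sum>v\<in>V. \<bar>D p \<bullet> v\<bar>) \<partial>M) \<le> ennreal a"
  shows "integrable M (\<lambda>p. Y p \<bullet> D p)" and "\<bar>\<integral>p. Y p \<bullet> D p \<partial>M\<bar> \<le> e * (1 + C) + a"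
proof -
  have pt: "\<bar>Y p \<bullet> D p\<bar> \<le> 1 / e * (norm (Y p - s (Y p)))\<^sup>2 + e * (norm (D p))\<^sup>2 + (\<Sum>v\<in>V. \<bar>D p \<bullet> v\<bar>)" for p
  proof -
    have "Y p \<bullet> D p = (Y p - s (Y p)) \<bullet> D p + D p \<bullet> s (Y p)"
      by (simp add: inner_diff_left inner_diff_right inner_commute)
    moreover have "\<bar>D p \<bullet> s (Y p)\<bar> \<le> (\<Sum>v\<in>V. \<bar>D p \<bullet> v\<bar>)"
      using V by (intro member_le_sum) auto
    moreover have "\<bar>(Y p - s (Y p)) \<bullet> D p\<bar> \<le> ((norm (Y p - s (Y p)))\<^sup>2 / e + e * (norm (D p))\<^sup>2) / 2"
      using e by (rule abs_inner_le_half)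
    moreover have "0 \<le> (norm (Y p - s (Y p)))\<^sup>2 / e + e * (norm (D p))\<^sup>2"
      using e by auto
    ultimately show ?thesis by (simp add: field_simps)
  qed
  have "(\<integral>\<^sup>+p. ennreal \<bar>Y p \<bullet> D p\<bar> \<partial>M) \<le> (\<integral>\<^sup>+p. ennreal (1 / e) * ennreal ((norm (Y p - s (Y p)))\<^sup>2)
     + ennreal e * ennreal ((norm (D p))\<^sup>2) + ennreal (\<Sum>v\<in>V. \<bar>D p \<bullet> v\<bar>) \<partial>M)"
    using pt e by (intro nn_integral_mono)
      (simp add: ennreal_leI sum_nonneg flip: ennreal_mult ennreal_plus)
  also have "\<dots> = ennreal (1 / e) * (\<integral>\<^sup>+p. ennreal ((norm (Y p - s (Y p)))\<^sup>2) \<partial>M)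
     + ennreal e * (\<integral>\<^sup>+p. ennreal ((norm (D p))\<^sup>2) \<partial>M) + (\<integral>\<^sup>+p. ennreal (\<Sum>v\<in>V. \<bar>D p \<bullet> v\<bar>) \<partial>M)"
    by (simp add: nn_integral_add nn_integral_cmult)
  also have "\<dots> \<le> ennreal (1 / e) * ennreal (e\<^sup>2) + ennreal e * ennreal C + ennreal a"
    using s by (intro add_mono mult_left_mono D VD) (auto simp: nn_integral_distr)
  also have "\<dots> = ennreal (e * (1 + C) + a)"
    using e C a by (simp add: power2_eq_square algebra_simps flip: ennreal_mult ennreal_plus)
  finally have le: "(\<integral>\<^sup>+p. ennreal \<bar>Y p \<bullet> D p\<bar> \<partial>M) \<le> ennreal (e * (1 + C) + a)" .
  then show i: "integrable M (\<lambda>p. Y p \<bullet> D p)"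
    by (intro integrableI_bounded) (auto simp: le_less_trans)
  have "ennreal \<bar>\<integral>p. Y p \<bullet> D p \<partial>M\<bar> \<le> ennreal (e * (1 + C) + a)"
    using order_trans[OF integral_norm_bound_ennreal[OF i]] le by simp
  then show "\<bar>\<integral>p. Y p \<bullet> D p \<partial>M\<bar> \<le> e * (1 + C) + a"
    using e C a by (subst (asm) ennreal_le_iff) auto
qed

subsection \<open>Transport cost along a geodesic\<close>

lemma distr_Pair_in_couplings:
  fixes f g :: "'a \<Rightarrow> 'h::second_countable_topology"
  assumes "prob_space M" and [measurable]: "f \<in> borel_measurable M" "g \<in> borel_measurable M"
  shows "distr M borel (\<lambda>p. (f p, g p)) \<in> couplings (distr M borel f) (distr M borel g)"
proof -
  have fg: "(\<lambda>p. (f p, g p)) \<in> measurable M borel"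
    by measurable
  have "fst \<in> measurable (borel :: ('h \<times> 'h) measure) borel" "snd \<in> measurable (borel :: ('h \<times> 'h) measure) borel"
    unfolding borel_prod[symmetric] by measurable
  then show ?thesis
    using prob_space.prob_space_distr[OF assms(1) fg]
    by (simp add: couplings_def borel_prob_def distr_distr[OF _ fg] comp_def)
qed

lemma square_integrable_diff:
  fixes f g :: "'a \<Rightarrow> 'h::{real_inner, second_countable_topology}"
  assumes [measurable]: "f \<in> borel_measurable M" "g \<in> borel_measurable M"
    and "integrable M (\<lambda>p. (norm (f p))\<^sup>2)" "integrable M (\<lambda>p. (norm (g p))\<^sup>2)"
  shows "integrable M (\<lambda>p. (norm (f p - g p))\<^sup>2)"
proof (rule Bochner_Integration.integrable_bound)
  show "integrable M (\<lambda>p. 2 * (norm (f p))\<^sup>2 + 2 * (norm (g p))\<^sup>2)"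
    using assms by simp
  show "AE p in M. norm ((norm (f p - g p))\<^sup>2) \<le> norm (2 * (norm (f p))\<^sup>2 + 2 * (norm (g p))\<^sup>2)"
    using norm_diff_squared_le[of "f _" "g _"] by simp
qed measurable

lemma transport_cost_distr_Pair:
  fixes f g :: "'a \<Rightarrow> 'h::{real_inner, second_countable_topology}"
  assumes [measurable]: "f \<in> borel_measurable M" "g \<in> borel_measurable M"
    and int: "integrable M (\<lambda>p. (norm (f p))\<^sup>2)" "integrable M (\<lambda>p. (norm (g p))\<^sup>2)"
  shows "transport_cost (distr M borel (\<lambda>p. (f p, g p))) = ennreal (\<integral>p. (norm (f p - g p))\<^sup>2 \<partial>M)"
proof -
  have fg: "(\<lambda>p. (f p, g p)) \<in> measurable M borel"
    by measurable
  have "(\<lambda>(x :: 'h, y). ennreal ((norm (x - y))\<^sup>2)) \<in> borel_measurable borel"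
    unfolding borel_prod[symmetric] by measurable
  then have "transport_cost (distr M borel (\<lambda>p. (f p, g p))) = (\<integral>\<^sup>+p. ennreal ((norm (f p - g p))\<^sup>2) \<partial>M)"
    unfolding transport_cost_def using fg by (subst nn_integral_distr) auto
  also have "\<dots> = ennreal (\<integral>p. (norm (f p - g p))\<^sup>2 \<partial>M)"
    by (rule nn_integral_eq_integral[OF square_integrable_diff]) (use int in auto)
  finally show ?thesis .
qed

lemma P2_second_moment:
  fixes \<mu> :: "'h::{real_inner, polish_space} measure"
  assumes "\<mu> \<in> P2" "distr M borel f = \<mu>" and [measurable]: "f \<in> borel_measurable M"
  shows "integrable M (\<lambda>p. (norm (f p))\<^sup>2)"
    and "(\<integral>\<^sup>+p. ennreal ((norm (f p))\<^sup>2) \<partial>M) = second_moment \<mu>"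
    and "(\<integral>p. (norm (f p))\<^sup>2 \<partial>M) = enn2real (second_moment \<mu>)"
proof -
  have "second_moment \<mu> < \<infinity>" using assms(1) by (simp add: P2_def)
  show e: "(\<integral>\<^sup>+p. ennreal ((norm (f p))\<^sup>2) \<partial>M) = second_moment \<mu>"
    unfolding second_moment_def assms(2)[symmetric] by (simp add: nn_integral_distr)
  show i: "integrable M (\<lambda>p. (norm (f p))\<^sup>2)"
    by (rule integrableI_bounded) (use e \<open>second_moment \<mu> < \<infinity>\<close> in auto)
  show "(\<integral>p. (norm (f p))\<^sup>2 \<partial>M) = enn2real (second_moment \<mu>)"
    using nn_integral_eq_integral[OF i] e by simp
qed

text \<open>Gluing in terms of random vectors on one probability space, so that costs become
  expectations that can be expanded: \<open>(Y, Z)\<close> has the given plan as its law and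
  \<open>(Z, X)\<close> has density \<open>h\<close>. The iterated integral in the last clause makes
  this usable with \<open>h\<close> in either orientation.\<close>

lemma glued_triple:
  fixes \<pi> :: "('h::{real_inner, polish_space} \<times> 'h) measure"
    and Q :: "'h measure" and h :: "'h \<times> 'h \<Rightarrow> ennreal"
  assumes \<pi>: "\<pi> \<in> couplings \<nu> P" and P2: "\<nu> \<in> P2" "P \<in> P2" "Q \<in> P2"
    and h [measurable]: "h \<in> borel_measurable borel"
    and hQ: "\<And>z. (\<integral>\<^sup>+x. h (z, x) \<partial>Q) = (1::ennreal)"
    and hP: "\<And>x. (\<integral>\<^sup>+z. h (z, x) \<partial>P) = 1"
  obtains \<sigma> :: "(('h \<times> 'h) \<times> 'h) measure" and Y Z X
  where "prob_space \<sigma>" "Y \<in> borel_measurable \<sigma>" "Z \<in> borel_measurable \<sigma>" "X \<in> borel_measurable \<sigma>"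
    and "distr \<sigma> borel Y = \<nu>" "distr \<sigma> borel Z = P" "distr \<sigma> borel X = Q"
    and "distr \<sigma> borel (\<lambda>p. (Y p, Z p)) = \<pi>"
    and "\<And>f. f \<in> borel_measurable borel \<Longrightarrow>
      (\<integral>\<^sup>+p. f (Z p, X p) \<partial>\<sigma>) = (\<integral>\<^sup>+z. (\<integral>\<^sup>+x. h (z, x) * f (z, x) \<partial>Q) \<partial>P)"
proof -
  have \<pi>': "\<pi> \<in> borel_prob" "distr \<pi> borel fst = \<nu>" "distr \<pi> borel snd = P"
    using \<pi> by (auto simp: couplings_def)
  have Q: "Q \<in> borel_prob" using P2 by (auto simp: P2_def)
  define \<sigma> where "\<sigma> = density (\<pi> \<Otimes>\<^sub>M Q) (\<lambda>p. h (snd (fst p), snd p))"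
  note gl = gluing[where \<gamma>=\<pi> and Q=Q and h=h, OF \<pi>'(1) Q h hQ hP[folded \<pi>'(3)], folded \<sigma>_def]
  have st: "sets \<sigma> = sets ((borel \<Otimes>\<^sub>M borel) \<Otimes>\<^sub>M borel)"
    using gl(1) unfolding borel_prod by (simp add: borel_prob_def)
  have m: "(\<lambda>p. fst (fst p)) \<in> borel_measurable \<sigma>" "(\<lambda>p. snd (fst p)) \<in> borel_measurable \<sigma>"
    "snd \<in> borel_measurable \<sigma>"
    unfolding measurable_cong_sets[OF st refl] by measurable
  have fm: "fst \<in> measurable \<sigma> borel"
    unfolding measurable_cong_sets[OF st refl] borel_prod[symmetric] by measurable
  have pm: "fst \<in> measurable (borel :: ('h \<times> 'h) measure) borel" "snd \<in> measurable (borel :: ('h \<times> 'h) measure) borel"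
    unfolding borel_prod[symmetric] by measurable
  interpret Q: prob_space Q using Q by (simp add: borel_prob_def)
  have [measurable_cong]: "sets P = sets borel" "sets Q = sets borel"
    using P2 by (auto simp: P2_def borel_prob_def)
  show ?thesis
  proof (rule that[OF _ m])
    show "prob_space \<sigma>" using gl(1) by (simp add: borel_prob_def)
    show "distr \<sigma> borel (\<lambda>p. fst (fst p)) = \<nu>"
      unfolding \<pi>'(2)[symmetric] by (subst gl(2)[symmetric], subst distr_distr[OF pm(1) fm]) (simp add: comp_def)
    show "distr \<sigma> borel (\<lambda>p. snd (fst p)) = P"
      unfolding \<pi>'(3)[symmetric] by (subst gl(2)[symmetric], subst distr_distr[OF pm(2) fm]) (simp add: comp_def)
    show "distr \<sigma> borel snd = Q" by (rule gl(3))
    show "distr \<sigma> borel (\<lambda>p. (fst (fst p), snd (fst p))) = \<pi>"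
      using gl(2) by simp
    fix f :: "'h \<times> 'h \<Rightarrow> ennreal" assume f: "f \<in> borel_measurable borel"
    then have [measurable]: "f \<in> borel_measurable (borel \<Otimes>\<^sub>M borel)" "h \<in> borel_measurable (borel \<Otimes>\<^sub>M borel)"
      using h by (simp_all only: borel_prod)
    have "(\<integral>\<^sup>+p. f (snd (fst p), snd p) \<partial>\<sigma>) = (\<integral>\<^sup>+p. h p * f p \<partial>(P \<Otimes>\<^sub>M Q))"
      using gl(4)[OF f] \<pi>'(3) by simp
    also have "\<dots> = (\<integral>\<^sup>+z. (\<integral>\<^sup>+x. h (z, x) * f (z, x) \<partial>Q) \<partial>P)"
      by (subst Q.nn_integral_fst[symmetric]) auto
    finally show "(\<integral>\<^sup>+p. f (snd (fst p), snd p) \<partial>\<sigma>) = \<dots>" .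
  qed
qed

text \<open>The previous estimate for the displacement \<open>Z - X\<close>, whose squared norm has
  expectation at most \<open>4 * B\<close> because both second moments are at most
  \<open>B\<close>.\<close>

lemma integral_inner_density_le:
  fixes \<mu> \<mu>' :: "'h::{real_inner, polish_space} measure" and X Y Z :: "'a \<Rightarrow> 'h"
  assumes [measurable]: "X \<in> borel_measurable M" "Y \<in> borel_measurable M" "Z \<in> borel_measurable M"
    and "\<mu> \<in> P2" "\<mu>' \<in> P2" "distr M borel X = \<mu>" "distr M borel Z = \<mu>'"
    and B: "second_moment \<mu> \<le> ennreal B" "second_moment \<mu>' \<le> ennreal B" "0 \<le> B"
    and [measurable]: "s \<in> borel_measurable borel"
    and V: "finite V" "range s \<subseteq> V" and e: "0 < e" "0 \<le> a"
    and s: "(\<integral>\<^sup>+y. ennreal ((norm (y - s y))\<^sup>2) \<partial>(distr M borel Y)) \<le> ennreal (e\<^sup>2)"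
    and VD: "(\<integral>\<^sup>+p. ennreal (\<Sum>v\<in>V. \<bar>(Z p - X p) \<bullet> v\<bar>) \<partial>M) \<le> ennreal a"
  shows "integrable M (\<lambda>p. Y p \<bullet> (Z p - X p))" (is ?i)
    and "\<bar>\<integral>p. Y p \<bullet> (Z p - X p) \<partial>M\<bar> \<le> e * (1 + 4 * B) + a" (is ?b)
    and "(\<integral>p. (norm (Z p - X p))\<^sup>2 \<partial>M) \<le> 4 * B" (is ?c)
proof -
  note iX = P2_second_moment[OF assms(4,6)]
  note iZ = P2_second_moment[OF assms(5,7)]
  have i: "integrable M (\<lambda>p. (norm (Z p - X p))\<^sup>2)"
    by (rule square_integrable_diff) (use iX(1) iZ(1) in auto)
  have "(\<integral>p. (norm (Z p - X p))\<^sup>2 \<partial>M) \<le> (\<integral>p. 2 * (norm (Z p))\<^sup>2 + 2 * (norm (X p))\<^sup>2 \<partial>M)"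
    using i iX(1) iZ(1) norm_diff_squared_le by (intro integral_mono) auto
  also have "\<dots> = 2 * (\<integral>p. (norm (Z p))\<^sup>2 \<partial>M) + 2 * (\<integral>p. (norm (X p))\<^sup>2 \<partial>M)"
    using iX(1) iZ(1) by simp
  also have "\<dots> \<le> 2 * B + 2 * B"
    using iX(3) iZ(3) B enn2real_leI by (intro add_mono) auto
  finally show c: ?c by simp
  then have "(\<integral>\<^sup>+p. ennreal ((norm (Z p - X p))\<^sup>2) \<partial>M) \<le> ennreal (4 * B)"
    using nn_integral_eq_integral[OF i] by (simp add: ennreal_leI)
  then show ?i ?b
    using abs_integral_inner_le[OF _ _ _ V e(1) _ e(2) s _ VD, of "4 * B"] B by auto
qed

text \<open>Two triples are glued from the same density. In \<sigma> the plan \<gamma> is extended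
  by \<open>X\<close>; in \<tau> the plan \<alpha> is extended by \<open>Z'\<close>, which yields a
  competitor for \<gamma>. Optimality transfers the cost of \<alpha> to the pair
  \<open>(Y, X)\<close> up to small inner products, and expanding the square around
  \<open>Y - X\<close> gives the gain \<open>(1 - t)\<^sup>2\<close>.\<close>

lemma displacement_cost_le:
  fixes \<mu> \<mu>' \<nu> :: "'h::{real_inner, polish_space} measure"
  assumes P2: "\<mu> \<in> P2" "\<mu>' \<in> P2" "\<nu> \<in> P2"
    and B: "second_moment \<mu> \<le> ennreal B" "second_moment \<mu>' \<le> ennreal B" "0 \<le> B"
    and \<alpha>: "\<alpha> \<in> couplings \<nu> \<mu>" and \<gamma>: "\<gamma> \<in> optimal_couplings \<nu> \<mu>'"
    and h: "h \<in> borel_measurable borel"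
    and h\<mu>: "\<And>z. (\<integral>\<^sup>+x. h (z, x) \<partial>\<mu>) = (1::ennreal)"
    and h\<mu>': "\<And>x. (\<integral>\<^sup>+z. h (z, x) \<partial>\<mu>') = 1"
    and hV: "(\<integral>\<^sup>+p. h p * ennreal (\<Sum>v\<in>V. \<bar>(fst p - snd p) \<bullet> v\<bar>) \<partial>(\<mu>' \<Otimes>\<^sub>M \<mu>)) \<le> ennreal a"
    and s: "s\<^sub>1 \<in> borel_measurable borel" "s\<^sub>2 \<in> borel_measurable borel"
    and V: "finite V" "range s\<^sub>1 \<subseteq> V" "range s\<^sub>2 \<subseteq> V" and e: "0 < e" "0 \<le> a"
    and s1: "(\<integral>\<^sup>+y. ennreal ((norm (y - s\<^sub>1 y))\<^sup>2) \<partial>\<nu>) \<le> ennreal (e\<^sup>2)"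
    and s2: "(\<integral>\<^sup>+y. ennreal ((norm (y - s\<^sub>2 y))\<^sup>2) \<partial>\<mu>) \<le> ennreal (e\<^sup>2)"
    and t: "0 \<le> t" "t \<le> 1"
  defines "\<epsilon> \<equiv> e * (1 + 4 * B) + a"
  shows "\<exists>\<beta> \<in> couplings (distr \<gamma> borel (\<lambda>(x\<^sub>0, x\<^sub>1). (1 - t) *\<^sub>R x\<^sub>0 + t *\<^sub>R x\<^sub>1)) \<mu>.
    transport_cost \<beta> \<le> ennreal ((1 - t)\<^sup>2 * enn2real (transport_cost \<alpha>) + 4 * B * t\<^sup>2 + 8 * \<epsilon>)"
proof -
  have \<gamma>c: "\<gamma> \<in> couplings \<nu> \<mu>'" and \<gamma>o: "\<And>\<gamma>'. \<gamma>' \<in> couplings \<nu> \<mu>' \<Longrightarrow> transport_cost \<gamma> \<le> transport_cost \<gamma>'"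
    using \<gamma> by (auto simp: optimal_couplings_def)
  have \<epsilon>0: "0 \<le> \<epsilon>" using e B by (simp add: \<epsilon>_def)
  have "prob_space \<mu>" "prob_space \<mu>'" and st [measurable_cong]: "sets \<mu> = sets borel" "sets \<mu>' = sets borel"
    using P2 by (auto simp: P2_def borel_prob_def)
  interpret \<mu>: prob_space \<mu> by fact
  interpret \<mu>': prob_space \<mu>' by fact
  interpret pair_sigma_finite \<mu>' \<mu> ..
  have hm [measurable]: "h \<in> borel_measurable (borel \<Otimes>\<^sub>M borel)"
    using h by (simp only: borel_prod)
  have h'm: "(\<lambda>p. h (snd p, fst p)) \<in> borel_measurable borel"
    unfolding borel_prod[symmetric] by measurable
  obtain \<sigma> :: "(('h \<times> 'h) \<times> 'h) measure" and Y Z X where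
    ps\<sigma>: "prob_space \<sigma>" and m\<sigma> [measurable]: "Y \<in> borel_measurable \<sigma>" "Z \<in> borel_measurable \<sigma>" "X \<in> borel_measurable \<sigma>"
    and d\<sigma>: "distr \<sigma> borel Y = \<nu>" "distr \<sigma> borel Z = \<mu>'" "distr \<sigma> borel X = \<mu>"
    and d\<sigma>\<gamma>: "distr \<sigma> borel (\<lambda>p. (Y p, Z p)) = \<gamma>"
    and int\<sigma>: "\<And>f. f \<in> borel_measurable borel \<Longrightarrow>
      (\<integral>\<^sup>+p. f (Z p, X p) \<partial>\<sigma>) = (\<integral>\<^sup>+z. (\<integral>\<^sup>+x. h (z, x) * f (z, x) \<partial>\<mu>) \<partial>\<mu>')"
    by (rule glued_triple[OF \<gamma>c P2(3,2,1) h h\<mu> h\<mu>']) (rule that)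
  \<comment> \<open>Here \<open>Z'\<close> is attached to \<open>X'\<close>, so the density is used
    with its arguments exchanged.\<close>
  obtain \<tau> :: "(('h \<times> 'h) \<times> 'h) measure" and Y' X' Z' where
    ps\<tau>: "prob_space \<tau>" and m\<tau> [measurable]: "Y' \<in> borel_measurable \<tau>" "X' \<in> borel_measurable \<tau>" "Z' \<in> borel_measurable \<tau>"
    and d\<tau>: "distr \<tau> borel Y' = \<nu>" "distr \<tau> borel X' = \<mu>" "distr \<tau> borel Z' = \<mu>'"
    and d\<tau>\<alpha>: "distr \<tau> borel (\<lambda>p. (Y' p, X' p)) = \<alpha>"
    and int\<tau>: "\<And>f. f \<in> borel_measurable borel \<Longrightarrow>
      (\<integral>\<^sup>+p. f (X' p, Z' p) \<partial>\<tau>) = (\<integral>\<^sup>+x. (\<integral>\<^sup>+z. h (z, x) * f (x, z) \<partial>\<mu>') \<partial>\<mu>)"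
    by (rule glued_triple[where h="\<lambda>p. h (snd p, fst p)", OF \<alpha> P2(3,1,2) h'm])
      (use h\<mu>' h\<mu> that in \<open>simp_all only: fst_conv snd_conv\<close>)
  have V\<sigma>: "(\<integral>\<^sup>+p. ennreal (\<Sum>v\<in>V. \<bar>(Z p - X p) \<bullet> v\<bar>) \<partial>\<sigma>) \<le> ennreal a"
  proof -
    have "(\<lambda>p :: 'h \<times> 'h. ennreal (\<Sum>v\<in>V. \<bar>(fst p - snd p) \<bullet> v\<bar>)) \<in> borel_measurable borel"
      unfolding borel_prod[symmetric] by measurable
    from int\<sigma>[OF this] have "(\<integral>\<^sup>+p. ennreal (\<Sum>v\<in>V. \<bar>(Z p - X p) \<bullet> v\<bar>) \<partial>\<sigma>)
      = (\<integral>\<^sup>+z. (\<integral>\<^sup>+x. h (z, x) * ennreal (\<Sum>v\<in>V. \<bar>(z - x) \<bullet> v\<bar>) \<partial>\<mu>) \<partial>\<mu>')"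
      by simp
    also have "\<dots> = (\<integral>\<^sup>+p. h p * ennreal (\<Sum>v\<in>V. \<bar>(fst p - snd p) \<bullet> v\<bar>) \<partial>(\<mu>' \<Otimes>\<^sub>M \<mu>))"
      by (subst \<mu>.nn_integral_fst[symmetric]) auto
    finally show ?thesis using hV by simp
  qed
  have V\<tau>: "(\<integral>\<^sup>+p. ennreal (\<Sum>v\<in>V. \<bar>(Z' p - X' p) \<bullet> v\<bar>) \<partial>\<tau>) \<le> ennreal a"
  proof -
    have "(\<lambda>p :: 'h \<times> 'h. ennreal (\<Sum>v\<in>V. \<bar>(snd p - fst p) \<bullet> v\<bar>)) \<in> borel_measurable borel"
      unfolding borel_prod[symmetric] by measurable
    from int\<tau>[OF this] have "(\<integral>\<^sup>+p. ennreal (\<Sum>v\<in>V. \<bar>(Z' p - X' p) \<bullet> v\<bar>) \<partial>\<tau>)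
      = (\<integral>\<^sup>+x. (\<integral>\<^sup>+z. h (z, x) * ennreal (\<Sum>v\<in>V. \<bar>(z - x) \<bullet> v\<bar>) \<partial>\<mu>') \<partial>\<mu>)"
      by simp
    also have "\<dots> = (\<integral>\<^sup>+p. h p * ennreal (\<Sum>v\<in>V. \<bar>(fst p - snd p) \<bullet> v\<bar>) \<partial>(\<mu>' \<Otimes>\<^sub>M \<mu>))"
      by (subst nn_integral_snd[symmetric]) auto
    finally show ?thesis using hV by simp
  qed
  note i\<sigma> = P2_second_moment(1)[OF P2(3) d\<sigma>(1) m\<sigma>(1)] P2_second_moment(1)[OF P2(2) d\<sigma>(2) m\<sigma>(2)]
    P2_second_moment(1)[OF P2(1) d\<sigma>(3) m\<sigma>(3)]
  note i\<tau> = P2_second_moment(1)[OF P2(3) d\<tau>(1) m\<tau>(1)] P2_second_moment(1)[OF P2(1) d\<tau>(2) m\<tau>(2)]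
    P2_second_moment(1)[OF P2(2) d\<tau>(3) m\<tau>(3)]
  note mom = P2_second_moment(3)[OF P2(2) d\<sigma>(2) m\<sigma>(2)] P2_second_moment(3)[OF P2(1) d\<sigma>(3) m\<sigma>(3)]
    P2_second_moment(3)[OF P2(1) d\<tau>(2) m\<tau>(2)] P2_second_moment(3)[OF P2(2) d\<tau>(3) m\<tau>(3)]
  note eY = integral_inner_density_le[OF m\<sigma>(3,1,2) P2(1,2) d\<sigma>(3,2) B s(1) V(1,2) e s1[folded d\<sigma>(1)] V\<sigma>, folded \<epsilon>_def]
  note eX = integral_inner_density_le[OF m\<sigma>(3,3,2) P2(1,2) d\<sigma>(3,2) B s(2) V(1,3) e s2[folded d\<sigma>(3)] V\<sigma>, folded \<epsilon>_def]
  note eY' = integral_inner_density_le[OF m\<tau>(2,1,3) P2(1,2) d\<tau>(2,3) B s(1) V(1,2) e s1[folded d\<tau>(1)] V\<tau>, folded \<epsilon>_def]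
  note iYX = square_integrable_diff[OF m\<sigma>(1,3) i\<sigma>(1,3)]
  note iZX = square_integrable_diff[OF m\<sigma>(2,3) i\<sigma>(2,3)]
  note iYZ = square_integrable_diff[OF m\<sigma>(1,2) i\<sigma>(1,2)]
  note iYX' = square_integrable_diff[OF m\<tau>(1,2) i\<tau>(1,2)]
  \<comment> \<open>\<open>(Y', Z')\<close> couples \<nu> with \<mu>', so \<gamma> is at least as
    cheap.\<close>
  have "transport_cost \<gamma> \<le> transport_cost (distr \<tau> borel (\<lambda>p. (Y' p, Z' p)))"
    by (rule \<gamma>o) (use distr_Pair_in_couplings[OF ps\<tau> m\<tau>(1,3)] d\<tau> in simp)
  then have opt: "(\<integral>p. (norm (Y p - Z p))\<^sup>2 \<partial>\<sigma>) \<le> (\<integral>p. (norm (Y' p - Z' p))\<^sup>2 \<partial>\<tau>)"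
    unfolding d\<sigma>\<gamma>[symmetric] transport_cost_distr_Pair[OF m\<sigma>(1,2) i\<sigma>(1,2)]
      transport_cost_distr_Pair[OF m\<tau>(1,3) i\<tau>(1,3)] by (subst (asm) ennreal_le_iff) auto
  \<comment> \<open>Replacing \<open>Z\<close> by \<open>X\<close> changes the cost by the second
    moments and an inner product with \<open>Z - X\<close>; the same is done in \<tau> with the
    roles of \<mu> and \<mu>' exchanged.\<close>
  have "(\<integral>p. (norm (Y p - X p))\<^sup>2 \<partial>\<sigma>)
      = (\<integral>p. (norm (Y p - Z p))\<^sup>2 + (norm (X p))\<^sup>2 - (norm (Z p))\<^sup>2 + 2 * (Y p \<bullet> (Z p - X p)) \<partial>\<sigma>)"
    by (intro Bochner_Integration.integral_cong refl, simp only: power2_norm_eq_inner)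
      (simp add: algebra_simps inner_commute)
  also have "\<dots> = (\<integral>p. (norm (Y p - Z p))\<^sup>2 \<partial>\<sigma>) + enn2real (second_moment \<mu>)
      - enn2real (second_moment \<mu>') + 2 * (\<integral>p. Y p \<bullet> (Z p - X p) \<partial>\<sigma>)"
    using i\<sigma> iYZ eY(1) mom by simp
  finally have c\<sigma>: "(\<integral>p. (norm (Y p - X p))\<^sup>2 \<partial>\<sigma>) = \<dots>" .
  have "(\<integral>p. (norm (Y' p - Z' p))\<^sup>2 \<partial>\<tau>)
      = (\<integral>p. (norm (Y' p - X' p))\<^sup>2 + (norm (Z' p))\<^sup>2 - (norm (X' p))\<^sup>2 - 2 * (Y' p \<bullet> (Z' p - X' p)) \<partial>\<tau>)"
    by (intro Bochner_Integration.integral_cong refl, simp only: power2_norm_eq_inner)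
      (simp add: algebra_simps inner_commute)
  also have "\<dots> = (\<integral>p. (norm (Y' p - X' p))\<^sup>2 \<partial>\<tau>) + enn2real (second_moment \<mu>')
      - enn2real (second_moment \<mu>) - 2 * (\<integral>p. Y' p \<bullet> (Z' p - X' p) \<partial>\<tau>)"
    using i\<tau> iYX' eY'(1) mom by simp
  finally have c\<tau>: "(\<integral>p. (norm (Y' p - Z' p))\<^sup>2 \<partial>\<tau>) = \<dots>" .
  have c\<alpha>: "(\<integral>p. (norm (Y' p - X' p))\<^sup>2 \<partial>\<tau>) = enn2real (transport_cost \<alpha>)"
    unfolding d\<tau>\<alpha>[symmetric] transport_cost_distr_Pair[OF m\<tau>(1,2) i\<tau>(1,2)] by simp
  \<comment> \<open>The second moments cancel between the two expansions. Each leaves an error of at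
    most \<open>2 * \<epsilon>\<close>.\<close>
  have cYX: "(\<integral>p. (norm (Y p - X p))\<^sup>2 \<partial>\<sigma>) \<le> enn2real (transport_cost \<alpha>) + 4 * \<epsilon>"
    using c\<sigma> c\<tau> c\<alpha> opt eY(2) eY'(2) by linarith
  define G where "G p = (1 - t) *\<^sub>R Y p + t *\<^sub>R Z p" for p
  have Gm [measurable]: "G \<in> borel_measurable \<sigma>" unfolding G_def by measurable
  \<comment> \<open>The interpolation is written as a difference, with coefficient
    \<open>- t\<close>, to fit the integrability of differences.\<close>
  have "integrable \<sigma> (\<lambda>p. (norm ((1 - t) *\<^sub>R Y p - (- t) *\<^sub>R Z p))\<^sup>2)"
    by (rule square_integrable_diff) (use i\<sigma> in \<open>auto simp: power_mult_distrib\<close>)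
  then have iG: "integrable \<sigma> (\<lambda>p. (norm (G p))\<^sup>2)"
    by (simp add: G_def)
  have dG: "distr \<sigma> borel G = distr \<gamma> borel (\<lambda>(x\<^sub>0, x\<^sub>1). (1 - t) *\<^sub>R x\<^sub>0 + t *\<^sub>R x\<^sub>1)"
  proof -
    have "(\<lambda>(x\<^sub>0 :: 'h, x\<^sub>1). (1 - t) *\<^sub>R x\<^sub>0 + t *\<^sub>R x\<^sub>1) \<in> borel_measurable borel"
      unfolding borel_prod[symmetric] by measurable
    moreover have "(\<lambda>p. (Y p, Z p)) \<in> measurable \<sigma> borel" by measurable
    ultimately show ?thesis
      unfolding d\<sigma>\<gamma>[symmetric] by (subst distr_distr) (auto simp: comp_def G_def[abs_def])
  qed
  \<comment> \<open>Since \<open>G - X\<close> is \<open>(1 - t)\<close> times \<open>Y - X\<close>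
    plus \<open>t\<close> times \<open>Z - X\<close>, the cross term splits into inner products of
    \<open>Y\<close> and of \<open>X\<close> with \<open>Z - X\<close>. The second one is the reason
    for approximating \<mu> by \<open>s\<^sub>2\<close> as well.\<close>
  have "(\<integral>p. (norm (G p - X p))\<^sup>2 \<partial>\<sigma>) = (\<integral>p. (1 - t)\<^sup>2 * (norm (Y p - X p))\<^sup>2
      + 2 * t * (1 - t) * (Y p \<bullet> (Z p - X p) - X p \<bullet> (Z p - X p)) + t\<^sup>2 * (norm (Z p - X p))\<^sup>2 \<partial>\<sigma>)"
    by (intro Bochner_Integration.integral_cong refl, simp only: power2_norm_eq_inner G_def)
      (simp add: algebra_simps inner_commute power2_eq_square)
  also have "\<dots> = (1 - t)\<^sup>2 * (\<integral>p. (norm (Y p - X p))\<^sup>2 \<partial>\<sigma>)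
      + 2 * t * (1 - t) * ((\<integral>p. Y p \<bullet> (Z p - X p) \<partial>\<sigma>) - (\<integral>p. X p \<bullet> (Z p - X p) \<partial>\<sigma>))
      + t\<^sup>2 * (\<integral>p. (norm (Z p - X p))\<^sup>2 \<partial>\<sigma>)"
    using iYX iZX eY(1) eX(1) by simp
  also have "\<dots> \<le> (1 - t)\<^sup>2 * (enn2real (transport_cost \<alpha>) + 4 * \<epsilon>) + 2 * t * (1 - t) * (2 * \<epsilon>) + t\<^sup>2 * (4 * B)"
    using eY(2) eX(2) t by (intro add_mono mult_left_mono cYX eY(3)) auto
  also have "\<dots> \<le> (1 - t)\<^sup>2 * enn2real (transport_cost \<alpha>) + 4 * B * t\<^sup>2 + 8 * \<epsilon>"
  proof -
    \<comment> \<open>The left side is \<open>4 * (1 - t)\<close>; it collects the error in the cost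
      of \<open>(Y, X)\<close> and that of the cross term.\<close>
    have "4 * ((1 - t)\<^sup>2 + t * (1 - t)) \<le> 8"
      using t by (simp add: power2_eq_square algebra_simps)
    then have "4 * ((1 - t)\<^sup>2 + t * (1 - t)) * \<epsilon> \<le> 8 * \<epsilon>"
      using \<epsilon>0 by (rule mult_right_mono)
    then show ?thesis by (simp add: algebra_simps)
  qed
  finally have "transport_cost (distr \<sigma> borel (\<lambda>p. (G p, X p)))
      \<le> ennreal ((1 - t)\<^sup>2 * enn2real (transport_cost \<alpha>) + 4 * B * t\<^sup>2 + 8 * \<epsilon>)"
    unfolding transport_cost_distr_Pair[OF Gm m\<sigma>(3) iG i\<sigma>(3)] by (rule ennreal_leI)
  then show ?thesis
    using distr_Pair_in_couplings[OF ps\<sigma> Gm m\<sigma>(3)] unfolding dG d\<sigma>(3) by blast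
qed

subsection \<open>Second moments and weak convergence\<close>

text \<open>The term added for \<open>q k\<close> is the tangent to the squared norm at
  \<open>q k\<close>. Finite maxima of these are weakly continuous minorants of the squared norm,
  and the initial value 0 makes them nonnegative.\<close>

primrec affine_sup :: "(nat \<Rightarrow> 'h::real_inner) \<Rightarrow> nat \<Rightarrow> 'h \<Rightarrow> real" where
  "affine_sup q 0 x = 0"
| "affine_sup q (Suc k) x = max (affine_sup q k x) (2 * (x \<bullet> q k) - (norm (q k))\<^sup>2)"

lemma norm_diff_squared:
  fixes x y :: "'h::real_inner"
  shows "(norm (x - y))\<^sup>2 = (norm x)\<^sup>2 - (2 * (x \<bullet> y) - (norm y)\<^sup>2)"
  by (simp only: power2_norm_eq_inner) (simp add: algebra_simps inner_commute)

text \<open>The approximants come from \<open>(norm x)\<^sup>2 = sup\<^sub>y (2 * (x \<bullet> y) - (norm y)\<^sup>2)\<close> with \<open>y\<close> running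
  through a dense sequence.\<close>

lemma weak_approximation_norm_squared:
  obtains \<phi> :: "nat \<Rightarrow> 'h::{real_inner, polish_space} \<Rightarrow> real"
  where "\<And>k. continuous_map weak_topology euclideanreal (\<phi> k)"
    and "\<And>k x. 0 \<le> \<phi> k x" "\<And>k x. \<phi> k x \<le> real k" "\<And>k x. \<phi> k x \<le> (norm x)\<^sup>2"
    and "\<And>x. incseq (\<lambda>k. \<phi> k x)" "\<And>x. (\<lambda>k. \<phi> k x) \<longlonglongrightarrow> (norm x)\<^sup>2"
proof -
  obtain D :: "'h set" where D: "countable D" "\<And>X. open X \<Longrightarrow> X \<noteq> {} \<Longrightarrow> \<exists>d\<in>D. d \<in> X"
    by (rule countable_dense_setE) blast
  have "D \<noteq> {}" using D(2)[of UNIV] by auto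
  define q where "q = from_nat_into D"
  have rq: "range q = D"
    using range_from_nat_into[OF \<open>D \<noteq> {}\<close> D(1)] by (simp add: q_def)
  define g where "g = affine_sup q"
  \<comment> \<open>The cap \<open>real k\<close> makes the approximants bounded, as narrow
    convergence requires, and keeps them increasing in \<open>k\<close>.\<close>
  define \<phi> where "\<phi> k x = min (real k) (g k x)" for k x
  have cg: "continuous_map weak_topology euclideanreal (g k)" for k
    unfolding g_def
    by (induction k) (auto intro!: continuous_map_real_max continuous_map_diff
        continuous_map_real_mult_left continuous_map_weak_inner)
  have g0: "0 \<le> g k x" for k x unfolding g_def by (induction k) auto
  have incg: "incseq (\<lambda>k. g k x)" for x by (rule incseq_SucI) (simp add: g_def)
  have ub: "2 * (x \<bullet> y) - (norm y)\<^sup>2 \<le> (norm x)\<^sup>2" for x y :: 'h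
    using norm_diff_squared[of x y] zero_le_power2[of "norm (x - y)"] by linarith
  have gle: "g k x \<le> (norm x)\<^sup>2" for k x unfolding g_def by (induction k) (auto simp: ub)
  have lb: "2 * (x \<bullet> q i) - (norm (q i))\<^sup>2 \<le> g k x" if "i < k" for i k x
    using incseqD[OF incg, of "Suc i" k x] that by (auto simp: g_def)
  show ?thesis
  proof (rule that[of \<phi>])
    show "continuous_map weak_topology euclideanreal (\<phi> k)" for k
      unfolding \<phi>_def by (intro continuous_map_real_min cg) auto
    show "0 \<le> \<phi> k x" "\<phi> k x \<le> real k" "\<phi> k x \<le> (norm x)\<^sup>2" for k x
      using g0 gle[of k x] by (auto simp: \<phi>_def)
    show "incseq (\<lambda>k. \<phi> k x)" for x
      using incseqD[OF incg[of x]] by (auto simp: \<phi>_def incseq_def min_le_iff_disj) 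
    fix x
    show "(\<lambda>k. \<phi> k x) \<longlonglongrightarrow> (norm x)\<^sup>2"
    proof (rule order_tendstoI)
      fix a assume "a > (norm x)\<^sup>2"
      then have "\<phi> k x < a" for k using gle[of k x] by (auto simp: \<phi>_def)
      then show "\<forall>\<^sub>F k in sequentially. \<phi> k x < a" by simp
    next
      fix a assume a: "a < (norm x)\<^sup>2"
      \<comment> \<open>The tangent at \<open>q i\<close> falls short of the squared norm at
        \<open>x\<close> by \<open>(norm (x - q i))\<^sup>2\<close>, so a point \<open>q i\<close>
        within \<open>sqrt d\<close> of \<open>x\<close> closes the gap \<open>d\<close>.\<close>
      define d where "d = (norm x)\<^sup>2 - a"
      have "0 < d" using a by (simp add: d_def)
      then obtain y where y: "y \<in> D" "y \<in> ball x (sqrt d)"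
        using D(2)[of "ball x (sqrt d)"] by fastforce
      obtain i where i: "y = q i" using y(1) rq by auto
      have "norm (x - y) < sqrt d" using y by (simp add: dist_norm)
      then have "(norm (x - y))\<^sup>2 < d"
        using \<open>0 < d\<close> by (metis norm_ge_zero real_sqrt_abs abs_of_nonneg real_sqrt_less_iff)
      then have *: "a < 2 * (x \<bullet> q i) - (norm (q i))\<^sup>2"
        using norm_diff_squared[of x y] by (simp add: i d_def)
      \<comment> \<open>\<open>k > i\<close> brings the tangent at \<open>q i\<close> into the
        maximum; the second condition lifts the cap \<open>real k\<close> above
        \<open>a\<close>.\<close>
      show "\<forall>\<^sub>F k in sequentially. a < \<phi> k x"
        using eventually_gt_at_top[of i] eventually_gt_at_top[of "nat \<lceil>a\<rceil>"]
      proof eventually_elim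
        case (elim k)
        then show ?case using lb[OF elim(1), of x] * by (simp add: \<phi>_def) linarith
      qed
    qed
  qed
qed

text \<open>Monotone convergence; it reaches the second moment through functions to which weak
  convergence applies.\<close>

lemma second_moment_SUP:
  fixes \<mu> :: "'h::{real_inner, polish_space} measure" and \<phi> :: "nat \<Rightarrow> 'h \<Rightarrow> real"
  assumes "sets \<mu> = sets borel" and [measurable]: "\<And>k. \<phi> k \<in> borel_measurable borel"
    and inc: "\<And>x. incseq (\<lambda>k. \<phi> k x)" and lim: "\<And>x. (\<lambda>k. \<phi> k x) \<longlonglongrightarrow> (norm x)\<^sup>2"
  shows "second_moment \<mu> = (SUP k. \<integral>\<^sup>+x. ennreal (\<phi> k x) \<partial>\<mu>)"
proof -
  have [measurable_cong]: "sets \<mu> = sets borel" by fact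
  have "(SUP k. ennreal (\<phi> k x)) = ennreal ((norm x)\<^sup>2)" for x
  proof (rule LIMSEQ_unique)
    show "(\<lambda>k. ennreal (\<phi> k x)) \<longlonglongrightarrow> (SUP k. ennreal (\<phi> k x))"
      using inc[of x] by (intro LIMSEQ_SUP) (auto simp: incseq_def ennreal_leI)
    show "(\<lambda>k. ennreal (\<phi> k x)) \<longlonglongrightarrow> ennreal ((norm x)\<^sup>2)"
      by (intro tendsto_ennrealI lim)
  qed
  then have "second_moment \<mu> = (\<integral>\<^sup>+x. (SUP k. ennreal (\<phi> k x)) \<partial>\<mu>)"
    by (simp add: second_moment_def)
  also have "\<dots> = (SUP k. \<integral>\<^sup>+x. ennreal (\<phi> k x) \<partial>\<mu>)"
    using inc by (intro nn_integral_monotone_convergence_SUP) (auto simp: incseq_def le_fun_def ennreal_leI)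
  finally show ?thesis .
qed

text \<open>Lower semicontinuity: every approximant of the squared norm is bounded and weakly
  continuous, so its integral keeps the bound \<open>B\<close> in the limit, and the supremum over
  the approximants is the second moment.\<close>

lemma second_moment_le_of_weak_limit:
  fixes \<mu> :: "'h::{real_inner, polish_space} measure"
  assumes mu: "\<mu> \<in> borel_prob" "\<And>n. \<mu>s n \<in> borel_prob"
    and conv: "weakly_narrowly_converges \<mu>s \<mu>"
    and B: "\<And>n. second_moment (\<mu>s n) \<le> ennreal B" "0 \<le> B"
  shows "second_moment \<mu> \<le> ennreal B"
proof -
  obtain \<phi> :: "nat \<Rightarrow> 'h \<Rightarrow> real" where
    \<phi>: "\<And>k. continuous_map weak_topology euclideanreal (\<phi> k)"
    "\<And>k x. 0 \<le> \<phi> k x" "\<And>k x. \<phi> k x \<le> real k" "\<And>k x. \<phi> k x \<le> (norm x)\<^sup>2"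
    "\<And>x. incseq (\<lambda>k. \<phi> k x)" "\<And>x. (\<lambda>k. \<phi> k x) \<longlonglongrightarrow> (norm x)\<^sup>2"
    by (rule weak_approximation_norm_squared) (rule that)
  note \<phi>m [measurable] = weakly_continuous_imp_borel_measurable[OF \<phi>(1)]
  have nn: "(\<integral>\<^sup>+x. ennreal (\<phi> k x) \<partial>\<nu>) = ennreal (\<integral>x. \<phi> k x \<partial>\<nu>)" if "\<nu> \<in> borel_prob" for \<nu> k
  proof (rule nn_integral_eq_integral)
    have [measurable_cong]: "sets \<nu> = sets borel" and "prob_space \<nu>"
      using that by (auto simp: borel_prob_def)
    then interpret prob_space \<nu> by simp
    show "integrable \<nu> (\<phi> k)"
      by (rule integrable_const_bound[where B="real k"]) (use \<phi>(2,3) in auto)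
  qed (use \<phi> in auto)
  have "(\<integral>x. \<phi> k x \<partial>\<mu>) \<le> B" for k
  proof (rule LIMSEQ_le_const2)
    have "bounded (range (\<phi> k))"
      using \<phi>(2,3) by (intro boundedI[of _ "real k"]) auto
    then show "(\<lambda>n. \<integral>x. \<phi> k x \<partial>\<mu>s n) \<longlonglongrightarrow> (\<integral>x. \<phi> k x \<partial>\<mu>)"
      using conv \<phi>(1) by (auto simp: weakly_narrowly_converges_def)
    have "(\<integral>x. \<phi> k x \<partial>\<mu>s n) \<le> B" for n
    proof -
      have "(\<integral>\<^sup>+x. ennreal (\<phi> k x) \<partial>\<mu>s n) \<le> second_moment (\<mu>s n)"
        unfolding second_moment_def by (intro nn_integral_mono ennreal_leI \<phi>)
      then have "ennreal (\<integral>x. \<phi> k x \<partial>\<mu>s n) \<le> ennreal B"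
        using B(1)[of n] nn[OF mu(2)] by (simp add: order_trans)
      then show ?thesis using B(2) by simp
    qed
    then show "\<exists>N. \<forall>n\<ge>N. (\<integral>x. \<phi> k x \<partial>\<mu>s n) \<le> B" by blast
  qed
  then show ?thesis
    using mu(1) \<phi>(5,6) by (subst second_moment_SUP[of _ \<phi>])
      (auto simp: borel_prob_def nn[OF mu(1)] intro!: SUP_least ennreal_leI)
qed

text \<open>The uniform boundedness principle via Baire: the closed sets \<open>A M\<close> cover
  the space, since convergent real sequences are bounded, so one of them contains a ball.\<close>

lemma weakly_convergent_imp_bounded:
  fixes xs :: "nat \<Rightarrow> 'h::{real_inner, complete_space}"
  assumes "limitin weak_topology xs x sequentially"
  shows "bounded (range xs)"
proof -
  have lim: "(\<lambda>n. xs n \<bullet> v) \<longlonglongrightarrow> x \<bullet> v" for v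
    using continuous_map_limit[OF continuous_map_weak_inner assms, of v] by (simp add: comp_def)
  define A where "A M = {v. \<forall>n. \<bar>xs n \<bullet> v\<bar> \<le> real M}" for M
  have cl: "closed (A M)" for M
  proof -
    have "A M = (\<Inter>n. {v. \<bar>xs n \<bullet> v\<bar> \<le> real M})" by (auto simp: A_def)
    also have "closed \<dots>" by (intro closed_INT ballI closed_Collect_le continuous_intros)
    finally show ?thesis .
  qed
  have "\<Union>(range A) = UNIV"
  proof (intro set_eqI iffI UNIV_I)
    fix v
    obtain C where "\<And>n. \<bar>xs n \<bullet> v\<bar> \<le> C"
      using convergent_imp_Bseq[OF convergentI[OF lim[of v]]] by (auto simp: Bseq_def)
    moreover obtain M where "C \<le> real M" using real_arch_simple by blast
    ultimately have "v \<in> A M" by (auto simp: A_def intro: order_trans)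
    then show "v \<in> \<Union>(range A)" by blast
  qed
  have "\<exists>M. interior (A M) \<noteq> {}"
  proof (rule ccontr)
    assume "\<nexists>M. interior (A M) \<noteq> {}"
    then have "euclidean interior_of \<Union>(range A) = {}"
      using cl by (intro Baire_category_alt) (auto simp: completely_metrizable_space_euclidean)
    then show False using \<open>\<Union>(range A) = UNIV\<close> by simp
  qed
  then obtain M v where "v \<in> interior (A M)" by blast
  then obtain r where r: "0 < r" "cball v r \<subseteq> A M"
    by (meson mem_interior_cball)
  have "norm (xs n) \<le> 2 * real M / r" for n
  proof (cases "xs n = 0")
    case False
    \<comment> \<open>Moving from the centre \<open>v\<close> by \<open>r\<close> in the direction
      of \<open>xs n\<close> stays in the ball and adds \<open>r * norm (xs n)\<close> to the inner
      product with \<open>xs n\<close>.\<close>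
    define u where "u = v + (r / norm (xs n)) *\<^sub>R xs n"
    have "u \<in> cball v r" "v \<in> cball v r" using r False by (auto simp: u_def dist_norm)
    then have "\<bar>xs n \<bullet> u\<bar> \<le> real M" "\<bar>xs n \<bullet> v\<bar> \<le> real M" using r(2) unfolding A_def by blast+
    moreover have "xs n \<bullet> u = xs n \<bullet> v + r * norm (xs n)"
      using False by (simp add: u_def inner_add_right dot_square_norm power2_eq_square)
    ultimately have "r * norm (xs n) \<le> 2 * real M" by linarith
    then show ?thesis using r by (simp add: field_simps)
  qed (use r in simp)
  then show ?thesis by (intro boundedI) auto
qed

section \<open>Limits in \<open>P2w_topology\<close>\<close>

lemma continuous_imp_seq_weakly_continuous:
  assumes "continuous_map weak_topology euclideanreal f"
  shows "seq_weakly_continuous f"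
  unfolding seq_weakly_continuous_def
  using continuous_map_limit[OF assms] by (auto simp: comp_def)

lemma bounded_div_norm_squared_tendsto_0:
  fixes f :: "'h::real_normed_vector \<Rightarrow> real"
  assumes "\<And>x. \<bar>f x\<bar> \<le> C"
  shows "((\<lambda>x. f x / (1 + (norm x)\<^sup>2)) \<longlongrightarrow> 0) at_infinity"
proof (rule Lim_null_comparison)
  have "filterlim (\<lambda>x::'h. 1 + (norm x)\<^sup>2) at_top at_infinity"
    by (intro filterlim_tendsto_add_at_top[OF tendsto_const] filterlim_pow_at_top filterlim_norm_at_top) simp
  then show "((\<lambda>x::'h. C / (1 + (norm x)\<^sup>2)) \<longlongrightarrow> 0) at_infinity"
    by (rule real_tendsto_divide_at_top[OF tendsto_const])
  show "\<forall>\<^sub>F x in at_infinity. norm (f x / (1 + (norm x)\<^sup>2)) \<le> C / (1 + (norm x)\<^sup>2)"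
    using assms by (intro always_eventually allI) (simp add: abs_divide divide_right_mono add_nonneg_nonneg)
qed

lemma P2w_limitin_integral:
  fixes \<mu> :: "'h::real_normed_vector measure"
  assumes lim: "limitin P2w_topology \<mu>s \<mu> sequentially"
    and \<zeta>: "seq_weakly_continuous \<zeta>" "((\<lambda>x. \<zeta> x / (1 + (norm x)\<^sup>2)) \<longlongrightarrow> 0) at_infinity"
  shows "(\<lambda>n. \<integral>x. \<zeta> x \<partial>\<mu>s n) \<longlonglongrightarrow> (\<integral>x. \<zeta> x \<partial>\<mu>)"
proof (rule topological_tendstoI)
  fix U :: "real set" assume U: "open U" "(\<integral>x. \<zeta> x \<partial>\<mu>) \<in> U"
  have \<mu>: "\<mu> \<in> P2" using lim by (simp add: limitin_def)
  have "openin P2w_topology {\<mu> \<in> P2. (\<integral>x. \<zeta> x \<partial>\<mu>) \<in> U}"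
    unfolding P2w_topology_def by (rule topology_generated_by_Basis) (use \<zeta> U in blast)
  then have "\<forall>\<^sub>F n in sequentially. \<mu>s n \<in> {\<mu> \<in> P2. (\<integral>x. \<zeta> x \<partial>\<mu>) \<in> U}"
    using lim \<mu> U unfolding limitin_def by blast
  then show "\<forall>\<^sub>F n in sequentially. (\<integral>x. \<zeta> x \<partial>\<mu>s n) \<in> U"
    by eventually_elim simp
qed

text \<open>Bounded weakly continuous functions are admissible test functions: they are sequentially
  weakly continuous and of subquadratic growth.\<close>

lemma P2w_limitin_imp_weakly_narrowly:
  fixes \<mu> :: "'h::real_normed_vector measure"
  assumes "limitin P2w_topology \<mu>s \<mu> sequentially"
  shows "weakly_narrowly_converges \<mu>s \<mu>"
  unfolding weakly_narrowly_converges_def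
proof (intro allI impI, elim conjE)
  fix f :: "'h \<Rightarrow> real"
  assume f: "continuous_map weak_topology euclideanreal f" "bounded (range f)"
  then obtain C where "\<And>x. \<bar>f x\<bar> \<le> C" by (auto simp: bounded_iff)
  then show "(\<lambda>n. \<integral>x. f x \<partial>\<mu>s n) \<longlonglongrightarrow> (\<integral>x. f x \<partial>\<mu>)"
    by (intro P2w_limitin_integral[OF assms] continuous_imp_seq_weakly_continuous f
        bounded_div_norm_squared_tendsto_0)
qed

text \<open>The squared norm is approached by a test function adapted to the sequence. If the
  moments were unbounded, some \<open>\<phi> (K j)\<close> would have integral above
  \<open>4 ^ j\<close> under some \<open>\<mu>s (N j)\<close>. The series \<zeta> of these functions
  with weights \<open>(1 / 2) ^ j\<close> is admissible, yet its integral under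
  \<open>\<mu>s (N j)\<close> is at least \<open>2 ^ j\<close>, so its integrals cannot
  converge.\<close>

lemma P2w_limitin_imp_bounded_second_moments:
  fixes \<mu> :: "'h::{real_inner, polish_space} measure"
  assumes lim: "limitin P2w_topology \<mu>s \<mu> sequentially" and P2: "\<And>n. \<mu>s n \<in> P2"
  shows "(SUP n. second_moment (\<mu>s n)) < \<infinity>"
proof (rule ccontr)
  assume "\<not> ?thesis"
  then have unb: "(SUP n. second_moment (\<mu>s n)) = \<infinity>" unfolding infinity_ennreal_def less_top[symmetric] by simp
  have bp: "\<mu>s n \<in> borel_prob" for n using P2 by (simp add: P2_def)
  have sets\<mu>s [measurable_cong]: "sets (\<mu>s n) = sets borel" for n using bp by (simp add: borel_prob_def)
  obtain \<phi> :: "nat \<Rightarrow> 'h \<Rightarrow> real" where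
    \<phi>: "\<And>k. continuous_map weak_topology euclideanreal (\<phi> k)"
    "\<And>k x. 0 \<le> \<phi> k x" "\<And>k x. \<phi> k x \<le> real k" "\<And>k x. \<phi> k x \<le> (norm x)\<^sup>2"
    "\<And>x. incseq (\<lambda>k. \<phi> k x)" "\<And>x. (\<lambda>k. \<phi> k x) \<longlonglongrightarrow> (norm x)\<^sup>2"
    by (rule weak_approximation_norm_squared) (rule that)
  note \<phi>m [measurable] = weakly_continuous_imp_borel_measurable[OF \<phi>(1)]
  have "\<exists>n k. ennreal (4 ^ j) < (\<integral>\<^sup>+x. ennreal (\<phi> k x) \<partial>\<mu>s n)" for j :: nat
  proof -
    have "ennreal (4 ^ j) < (SUP n. second_moment (\<mu>s n))" unfolding unb by simp
    then obtain n where "ennreal (4 ^ j) < second_moment (\<mu>s n)" by (auto simp: less_SUP_iff)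
    then have "ennreal (4 ^ j) < (SUP k. \<integral>\<^sup>+x. ennreal (\<phi> k x) \<partial>\<mu>s n)"
      using second_moment_SUP[OF sets\<mu>s \<phi>m \<phi>(5,6)] by simp
    then show ?thesis by (auto simp: less_SUP_iff)
  qed
  then obtain N K where NK: "\<And>j. ennreal (4 ^ j) < (\<integral>\<^sup>+x. ennreal (\<phi> (K j) x) \<partial>\<mu>s (N j))"
    by metis
  define \<zeta> where "\<zeta> x = (\<Sum>j. (1 / 2) ^ j * \<phi> (K j) x)" for x
  have term_le: "(1 / 2) ^ j * \<phi> (K j) x \<le> (1 / 2) ^ j * (norm x)\<^sup>2" for j x
    by (intro mult_left_mono \<phi>) auto
  have geo: "summable (\<lambda>j. (1 / 2 :: real) ^ j * c)" for c
    by (intro summable_mult2 summable_geometric) simp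
  have summ: "summable (\<lambda>j. (1 / 2) ^ j * \<phi> (K j) x)" for x
    by (rule summable_comparison_test'[OF geo[of "(norm x)\<^sup>2"], of 0]) (use term_le \<phi>(2) in auto)
  have \<zeta>0: "0 \<le> \<zeta> x" for x
    unfolding \<zeta>_def by (intro suminf_nonneg summ) (use \<phi>(2) in auto)
  have \<zeta>le: "\<zeta> x \<le> 2 * (norm x)\<^sup>2" for x
  proof -
    have "\<zeta> x \<le> (\<Sum>j. (1 / 2) ^ j * (norm x)\<^sup>2)"
      unfolding \<zeta>_def by (intro suminf_le term_le summ geo)
    also have "\<dots> = 2 * (norm x)\<^sup>2"
      by (subst suminf_mult2[symmetric]) (simp_all add: suminf_geometric summable_geometric)
    finally show ?thesis .
  qed
  have \<zeta>m [measurable]: "\<zeta> \<in> borel_measurable borel"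
    unfolding \<zeta>_def by measurable
  have "seq_weakly_continuous \<zeta>"
    unfolding seq_weakly_continuous_def
  proof (intro allI impI)
    fix xs and x :: 'h assume xs: "limitin weak_topology xs x sequentially"
    \<comment> \<open>Boundedness of weakly convergent sequences supplies the summable majorant
      \<open>(1 / 2) ^ j * R\<^sup>2\<close>, and Tannery's theorem permits the limit term by
      term.\<close>
    then obtain R where R: "\<And>n. norm (xs n) \<le> R"
      using weakly_convergent_imp_bounded by (fastforce simp: bounded_iff)
    show "(\<lambda>n. \<zeta> (xs n)) \<longlonglongrightarrow> \<zeta> x"
      unfolding \<zeta>_def
    proof (rule tannerys_theorem[THEN conjunct2, THEN conjunct2])
      show "(\<lambda>n. (1 / 2) ^ j * \<phi> (K j) (xs n)) \<longlonglongrightarrow> (1 / 2) ^ j * \<phi> (K j) x" for j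
        using continuous_imp_seq_weakly_continuous[OF \<phi>(1)] xs
        by (intro tendsto_mult_left) (auto simp: seq_weakly_continuous_def)
      show "\<forall>\<^sub>F (j, n) in at_top \<times>\<^sub>F sequentially. norm ((1 / 2) ^ j * \<phi> (K j) (xs n)) \<le> (1 / 2) ^ j * R\<^sup>2"
      proof (intro always_eventually allI, clarify)
        fix j n
        have "(norm (xs n))\<^sup>2 \<le> R\<^sup>2" by (intro power_mono R) auto
        then show "norm ((1 / 2) ^ j * \<phi> (K j) (xs n)) \<le> (1 / 2) ^ j * R\<^sup>2"
          using \<phi>(2,4)[of "K j" "xs n"] by (auto simp: abs_mult)
      qed
    qed (use geo in auto)
  qed
  moreover have "((\<lambda>x. \<zeta> x / (1 + (norm x)\<^sup>2)) \<longlongrightarrow> 0) at_infinity"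
  \<comment> \<open>\<open>at_infinity\<close> is trivial for the zero space, where the limit is
    vacuous; Tannery's theorem is applied to a nontrivial filter.\<close>
  proof (cases "(at_infinity :: 'h filter) = bot")
    case False
    \<comment> \<open>Each term vanishes at infinity because \<open>\<phi> (K j)\<close> is bounded,
      while \<open>\<phi> (K j) x \<le> (norm x)\<^sup>2\<close> gives the majorant
      \<open>(1 / 2) ^ j\<close> uniformly in \<open>x\<close>.\<close>
    have "((\<lambda>x. \<Sum>j. (1 / 2) ^ j * \<phi> (K j) x / (1 + (norm x)\<^sup>2)) \<longlongrightarrow> (\<Sum>j::nat. 0)) at_infinity"
    proof (rule tannerys_theorem[THEN conjunct2, THEN conjunct2])
      show "((\<lambda>x. (1 / 2) ^ j * \<phi> (K j) x / (1 + (norm x)\<^sup>2)) \<longlongrightarrow> 0) at_infinity" for j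
      proof (rule bounded_div_norm_squared_tendsto_0[where C="(1 / 2) ^ j * real (K j)"])
        show "\<bar>(1 / 2) ^ j * \<phi> (K j) x\<bar> \<le> (1 / 2) ^ j * real (K j)" for x
          using \<phi>(2,3)[of "K j" x] by (auto simp: abs_mult)
      qed
      show "\<forall>\<^sub>F (j, x) in at_top \<times>\<^sub>F at_infinity. norm ((1 / 2) ^ j * \<phi> (K j) x / (1 + (norm x)\<^sup>2)) \<le> (1 / 2) ^ j * 1"
      proof (intro always_eventually allI, clarify)
        fix j and x :: 'h
        have "\<phi> (K j) x / (1 + (norm x)\<^sup>2) \<le> 1" using \<phi>(4)[of "K j" x] by (simp add: field_simps add_pos_nonneg)
        then have "(1 / 2) ^ j * (\<phi> (K j) x / (1 + (norm x)\<^sup>2)) \<le> (1 / 2) ^ j * 1"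
          by (intro mult_left_mono) auto
        then show "norm ((1 / 2) ^ j * \<phi> (K j) x / (1 + (norm x)\<^sup>2)) \<le> (1 / 2) ^ j * 1"
          using \<phi>(2)[of "K j" x] by simp
      qed
    qed (use geo False in auto)
    moreover have "(\<Sum>j. (1 / 2) ^ j * \<phi> (K j) x / (1 + (norm x)\<^sup>2)) = \<zeta> x / (1 + (norm x)\<^sup>2)" for x
      unfolding \<zeta>_def by (rule suminf_divide[OF summ])
    ultimately show ?thesis by simp
  qed simp
  ultimately have "(\<lambda>n. \<integral>x. \<zeta> x \<partial>\<mu>s n) \<longlonglongrightarrow> (\<integral>x. \<zeta> x \<partial>\<mu>)"
    by (rule P2w_limitin_integral[OF lim])
  then obtain C where C: "\<And>n. \<bar>\<integral>x. \<zeta> x \<partial>\<mu>s n\<bar> \<le> C"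
    using Bseq_def[THEN iffD1, OF convergent_imp_Bseq[OF convergentI]] by force
  \<comment> \<open>For this \<open>j\<close> the single summand \<open>j\<close> of \<zeta> already
    has integral at least \<open>(1 / 2) ^ j * 4 ^ j = 2 ^ j > C\<close> under
    \<open>\<mu>s (N j)\<close>.\<close>
  obtain j where j: "C < 2 ^ j" using real_arch_pow[of 2 C] by auto
  have i2: "integrable (\<mu>s n) (\<lambda>x. (norm x)\<^sup>2)" for n
    using P2_second_moment(1)[OF P2, of "\<mu>s n" "\<lambda>x. x" n] by (simp add: distr_id2 sets\<mu>s)
  have i\<zeta>: "integrable (\<mu>s n) \<zeta>" for n
    by (rule Bochner_Integration.integrable_bound[of _ "\<lambda>x. 2 * (norm x)\<^sup>2"])
      (use i2 \<zeta>0 \<zeta>le in auto)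
  have i\<phi>: "integrable (\<mu>s n) (\<phi> k)" for n k
    by (rule Bochner_Integration.integrable_bound[OF i2]) (use \<phi> in auto)
  have "ennreal (4 ^ j) < ennreal (\<integral>x. \<phi> (K j) x \<partial>\<mu>s (N j))"
    using NK[of j] nn_integral_eq_integral[OF i\<phi>] \<phi>(2) by simp
  then have "4 ^ j < (\<integral>x. \<phi> (K j) x \<partial>\<mu>s (N j))" by (subst (asm) ennreal_less_iff) auto
  then have "(1 / 2) ^ j * 4 ^ j \<le> (1 / 2) ^ j * (\<integral>x. \<phi> (K j) x \<partial>\<mu>s (N j))"
    by (intro mult_left_mono) auto
  also have "\<dots> = (\<integral>x. (1 / 2) ^ j * \<phi> (K j) x \<partial>\<mu>s (N j))" by simp
  also have "\<dots> \<le> (\<integral>x. \<zeta> x \<partial>\<mu>s (N j))"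
  proof (intro integral_mono i\<zeta> integrable_mult_right i\<phi>)
    fix x
    have "(\<Sum>i\<in>{j}. (1 / 2) ^ i * \<phi> (K i) x) \<le> \<zeta> x"
      unfolding \<zeta>_def by (intro sum_le_suminf summ) (use \<phi>(2) in auto)
    then show "(1 / 2) ^ j * \<phi> (K j) x \<le> \<zeta> x" by simp
  qed
  also have "\<dots> \<le> C" using C[of "N j"] by linarith
  finally have "(1 / 2) ^ j * 4 ^ j \<le> C" .
  then show False using j by (simp flip: power_mult_distrib)
qed

subsection \<open>Weak closedness\<close>

lemma P2_coupling_cost_finite:
  fixes \<mu> \<nu> :: "'h::{real_inner, polish_space} measure"
  assumes "\<mu> \<in> P2" "\<nu> \<in> P2" "\<alpha> \<in> couplings \<mu> \<nu>"
  shows "transport_cost \<alpha> = ennreal (enn2real (transport_cost \<alpha>))"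
proof -
  have \<alpha>: "sets \<alpha> = sets borel" "distr \<alpha> borel fst = \<mu>" "distr \<alpha> borel snd = \<nu>"
    using assms(3) by (auto simp: couplings_def borel_prob_def)
  have m: "fst \<in> borel_measurable \<alpha>" "snd \<in> borel_measurable \<alpha>"
    unfolding measurable_cong_sets[OF \<alpha>(1) refl] borel_prod[symmetric] by measurable
  have "distr \<alpha> borel (\<lambda>p. (fst p, snd p)) = \<alpha>"
    using \<alpha>(1) by (simp add: distr_id2)
  then show ?thesis
    using transport_cost_distr_Pair[OF m P2_second_moment(1)[OF assms(1) \<alpha>(2) m(1)]
        P2_second_moment(1)[OF assms(2) \<alpha>(3) m(2)]] by simp
qed

lemma couplings_nonempty:
  fixes \<mu> \<nu> :: "'h::{real_inner, polish_space} measure"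
  assumes "\<mu> \<in> borel_prob" "\<nu> \<in> borel_prob"
  shows "couplings \<mu> \<nu> \<noteq> {}"
proof -
  have st: "sets \<mu> = sets borel" "sets \<nu> = sets borel" and "prob_space \<mu>" "prob_space \<nu>"
    using assms by (auto simp: borel_prob_def)
  interpret \<mu>: prob_space \<mu> by fact
  interpret \<nu>: prob_space \<nu> by fact
  interpret pair_prob_space \<mu> \<nu> ..
  have m: "fst \<in> borel_measurable (\<mu> \<Otimes>\<^sub>M \<nu>)" "snd \<in> borel_measurable (\<mu> \<Otimes>\<^sub>M \<nu>)"
    using st measurable_fst[of \<mu> \<nu>] measurable_snd[of \<mu> \<nu>]
    by (simp_all add: measurable_cong_sets[OF refl st(1)] measurable_cong_sets[OF refl st(2)])
  have "distr (\<mu> \<Otimes>\<^sub>M \<nu>) borel fst = distr (\<mu> \<Otimes>\<^sub>M \<nu>) \<mu> fst"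
    "distr (\<mu> \<Otimes>\<^sub>M \<nu>) borel snd = distr (\<mu> \<Otimes>\<^sub>M \<nu>) \<nu> snd"
    using st by (auto intro!: distr_cong)
  moreover have "distr (\<mu> \<Otimes>\<^sub>M \<nu>) \<mu> fst = \<mu>" by (rule \<nu>.distr_pair_fst)
  moreover have "distr (\<mu> \<Otimes>\<^sub>M \<nu>) \<nu> snd = \<nu>"
  proof (rule measure_eqI)
    fix A assume "A \<in> sets (distr (\<mu> \<Otimes>\<^sub>M \<nu>) \<nu> snd)"
    then have A: "A \<in> sets \<nu>" by simp
    have "snd -` A \<inter> space (\<mu> \<Otimes>\<^sub>M \<nu>) = space \<mu> \<times> A"
      using sets.sets_into_space[OF A] by (auto simp: space_pair_measure)
    then show "emeasure (distr (\<mu> \<Otimes>\<^sub>M \<nu>) \<nu> snd) A = emeasure \<nu> A"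
      using A by (simp add: emeasure_distr \<nu>.emeasure_pair_measure_Times \<mu>.emeasure_space_1)
  qed simp
  ultimately show ?thesis
    using distr_Pair_in_couplings[OF prob_space_axioms m] by auto
qed

text \<open>The coupling runs from \<nu> to \<mu>, so its coordinates are swapped first, which
  preserves the cost.\<close>

lemma W2_le_transport_cost:
  fixes \<mu> \<nu> :: "'h::{real_inner, polish_space} measure"
  assumes "\<mu> \<in> P2" "\<nu> \<in> P2" "\<alpha> \<in> couplings \<nu> \<mu>"
  shows "(W2 \<mu> \<nu>)\<^sup>2 \<le> enn2real (transport_cost \<alpha>)"
proof -
  have \<alpha>: "sets \<alpha> = sets borel" "distr \<alpha> borel fst = \<nu>" "distr \<alpha> borel snd = \<mu>" "prob_space \<alpha>"
    using assms(3) by (auto simp: couplings_def borel_prob_def)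
  have m: "fst \<in> borel_measurable \<alpha>" "snd \<in> borel_measurable \<alpha>"
    unfolding measurable_cong_sets[OF \<alpha>(1) refl] borel_prod[symmetric] by measurable
  note sq = P2_second_moment(1)[OF assms(2) \<alpha>(2) m(1)] P2_second_moment(1)[OF assms(1) \<alpha>(3) m(2)]
  define \<alpha>' where "\<alpha>' = distr \<alpha> borel (\<lambda>p. (snd p, fst p))"
  have "distr \<alpha> borel (\<lambda>p. (fst p, snd p)) = \<alpha>"
    using \<alpha>(1) by (simp add: distr_id2)
  then have cost: "transport_cost \<alpha>' = transport_cost \<alpha>"
    using transport_cost_distr_Pair[OF m sq] transport_cost_distr_Pair[OF m(2,1) sq(2,1)]
    by (simp add: \<alpha>'_def norm_minus_commute)
  have "\<alpha>' \<in> couplings \<mu> \<nu>"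
    using distr_Pair_in_couplings[OF \<alpha>(4) m(2,1)] \<alpha>(2,3) by (simp add: \<alpha>'_def)
  then have "(INF \<gamma>\<in>couplings \<mu> \<nu>. transport_cost \<gamma>) \<le> transport_cost \<alpha>"
    using cost by (metis INF_lower)
  \<comment> \<open>Finiteness matters because \<open>enn2real\<close> sends infinity to 0 and is
    monotone only below it.\<close>
  moreover have "transport_cost \<alpha> < top"
    using P2_coupling_cost_finite[OF assms(2,1,3)] by (metis ennreal_less_top)
  ultimately show ?thesis
    by (simp add: W2_def enn2real_mono)
qed

lemma weak_limit_in_convex_closed:
  fixes K :: "'h::{real_inner, polish_space} measure set"
  assumes conv: "geodesically_convex K" and cl: "closedin W2_topology K"
    and \<mu>s: "\<And>n. \<mu>s n \<in> K" and bnd: "(SUP n. second_moment (\<mu>s n)) < \<infinity>"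
    and \<mu>: "\<mu> \<in> borel_prob" and lim: "weakly_narrowly_converges \<mu>s \<mu>"
  shows "\<mu> \<in> K"
proof (rule ccontr)
  assume "\<mu> \<notin> K"
  have KP2: "\<nu> \<in> P2" if "\<nu> \<in> K" for \<nu> using conv that by (auto simp: geodesically_convex_def)
  define B where "B = enn2real (SUP n. second_moment (\<mu>s n))"
  have B0: "0 \<le> B" by (simp add: B_def)
  have B\<mu>s: "second_moment (\<mu>s n) \<le> ennreal B" for n
    using bnd SUP_upper[of n UNIV "\<lambda>n. second_moment (\<mu>s n)"] by (simp add: B_def)
  have bp: "\<mu>s n \<in> borel_prob" for n using KP2[OF \<mu>s] by (simp add: P2_def)
  have B\<mu>: "second_moment \<mu> \<le> ennreal B"
    by (rule second_moment_le_of_weak_limit[OF \<mu> bp lim B\<mu>s B0])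
  then have P2: "\<mu> \<in> P2" using \<mu> by (simp add: P2_def le_less_trans)
  \<comment> \<open>The infimum over \<open>K\<close> and over plans is taken at once, so no optimal
    plan ending in \<mu> has to be chosen.\<close>
  define S where "S = {enn2real (transport_cost \<alpha>) | \<alpha> \<nu>. \<nu> \<in> K \<and> \<alpha> \<in> couplings \<nu> \<mu>}"
  have "openin W2_topology (P2 - K)" using cl by (simp add: closedin_def)
  \<comment> \<open>Closedness of \<open>K\<close> gives a ball around \<mu> that avoids it; hence
    \<open>r\<^sup>2\<close> bounds \<open>S\<close> from below and its infimum \<open>D\<close> is
    positive.\<close>
  then obtain r where r: "0 < r" "{\<nu> \<in> P2. W2 \<mu> \<nu> < r} \<subseteq> P2 - K"
    unfolding openin_W2_topology using P2 \<open>\<mu> \<notin> K\<close> by blast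
  have Sr: "r\<^sup>2 \<le> x" if x: "x \<in> S" for x
  proof -
    obtain \<alpha> \<nu> where *: "x = enn2real (transport_cost \<alpha>)" "\<nu> \<in> K" "\<alpha> \<in> couplings \<nu> \<mu>"
      using x by (auto simp: S_def)
    then have "r \<le> W2 \<mu> \<nu>" using r(2) KP2 by force
    then have "r\<^sup>2 \<le> (W2 \<mu> \<nu>)\<^sup>2" using r(1) by (intro power_mono) auto
    also have "\<dots> \<le> x" unfolding *(1) by (rule W2_le_transport_cost[OF P2 KP2[OF *(2)] *(3)])
    finally show ?thesis .
  qed
  have Sne: "S \<noteq> {}"
    using couplings_nonempty[OF bp \<mu>] \<mu>s[of 0] by (fastforce simp: S_def)
  have bdd: "bdd_below S" using Sr by (rule bdd_belowI)
  define D where "D = Inf S"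
  have D: "0 < D" using cInf_greatest[OF Sne Sr] r(1) by (simp add: D_def) (meson less_le_trans zero_less_power)
  have SD: "D \<le> x" if "x \<in> S" for x unfolding D_def by (rule cInf_lower[OF that bdd])
  \<comment> \<open>This \<open>t\<close> minimises
    \<open>- 2 * t * D + t\<^sup>2 * (D + 4 * B)\<close>; the minimum is
    \<open>- t * D\<close>.\<close>
  define t where "t = D / (D + 4 * B)"
  have t: "0 < t" "t \<le> 1" "t * (D + 4 * B) = D" using D B0 by (auto simp: t_def)
  \<comment> \<open>The gain is \<open>4 * \<eta>\<close>. One \<eta> is lost by choosing \<nu>
    almost optimal and one by the coupling errors, which leaves \<open>2 * \<eta>\<close> for the
    contradiction.\<close>
  define \<eta> where "\<eta> = t * D / 4"
  have \<eta>: "0 < \<eta>" using t D by (simp add: \<eta>_def)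
  obtain c where "c \<in> S" "c < D + \<eta>"
    using cInf_lessD[OF Sne, of "D + \<eta>"] \<eta> by (auto simp: D_def)
  then obtain \<alpha> \<nu> where \<alpha>: "enn2real (transport_cost \<alpha>) < D + \<eta>" "\<nu> \<in> K" "\<alpha> \<in> couplings \<nu> \<mu>"
    by (auto simp: S_def)
  \<comment> \<open>\<open>e\<close> and \<open>a\<close> make the error
    \<open>8 * \<epsilon>\<close> of the displacement estimate equal to \<eta>, half from
    each.\<close>
  define e where "e = \<eta> / 16 / (1 + 4 * B)"
  have e: "0 < e" "0 < e\<^sup>2" using \<eta> B0 by (auto simp: e_def)
  define a where "a = \<eta> / 16"
  have a: "0 < a" using \<eta> by (simp add: a_def)
  have ea: "8 * (e * (1 + 4 * B) + a) = \<eta>"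
  proof -
    have "1 + 4 * B \<noteq> 0" using B0 by linarith
    then have "e * (1 + 4 * B) = \<eta> / 16"
      unfolding e_def by (rule nonzero_eq_divide_eq[THEN iffD1, OF _ refl])
    then show ?thesis by (simp add: a_def)
  qed
  obtain s\<^sub>1 :: "'h \<Rightarrow> 'h" and V\<^sub>1 where s1: "s\<^sub>1 \<in> borel_measurable borel" "finite V\<^sub>1" "range s\<^sub>1 \<subseteq> V\<^sub>1"
    "(\<integral>\<^sup>+y. ennreal ((norm (y - s\<^sub>1 y))\<^sup>2) \<partial>\<nu>) \<le> ennreal (e\<^sup>2)"
    by (rule simple_approx_second_moment[OF KP2[OF \<alpha>(2)] e(2)]) (rule that)
  obtain s\<^sub>2 :: "'h \<Rightarrow> 'h" and V\<^sub>2 where s2: "s\<^sub>2 \<in> borel_measurable borel" "finite V\<^sub>2" "range s\<^sub>2 \<subseteq> V\<^sub>2"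
    "(\<integral>\<^sup>+y. ennreal ((norm (y - s\<^sub>2 y))\<^sup>2) \<partial>\<mu>) \<le> ennreal (e\<^sup>2)"
    by (rule simple_approx_second_moment[OF P2 e(2)]) (rule that)
  \<comment> \<open>One set of test vectors serves both approximations. It depends on \<nu> and
    \<mu> only and is fixed before the index \<open>n\<close> is chosen.\<close>
  define V where "V = V\<^sub>1 \<union> V\<^sub>2"
  have V: "finite V" "range s\<^sub>1 \<subseteq> V" "range s\<^sub>2 \<subseteq> V" using s1 s2 by (auto simp: V_def)
  from eventually_weak_coupling_density[OF \<mu> bp lim B\<mu> B\<mu>s B0 V(1) a]
  obtain n and h :: "'h \<times> 'h \<Rightarrow> ennreal" where h: "h \<in> borel_measurable borel"
    "\<And>z. (\<integral>\<^sup>+x. h (z, x) \<partial>\<mu>) = 1" "\<And>x. (\<integral>\<^sup>+z. h (z, x) \<partial>\<mu>s n) = 1"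
    "(\<integral>\<^sup>+p. h p * ennreal (\<Sum>v\<in>V. \<bar>(fst p - snd p) \<bullet> v\<bar>) \<partial>(\<mu>s n \<Otimes>\<^sub>M \<mu>)) \<le> ennreal a"
    unfolding eventually_sequentially by blast
  obtain \<gamma> where \<gamma>: "\<gamma> \<in> optimal_couplings \<nu> (\<mu>s n)"
    "\<And>t. t \<in> {0..1} \<Longrightarrow> distr \<gamma> borel (\<lambda>(x\<^sub>0, x\<^sub>1). (1 - t) *\<^sub>R x\<^sub>0 + t *\<^sub>R x\<^sub>1) \<in> K"
    using conv \<alpha>(2) \<mu>s[of n] unfolding geodesically_convex_def by blast
  obtain \<beta> where \<beta>: "\<beta> \<in> couplings (distr \<gamma> borel (\<lambda>(x\<^sub>0, x\<^sub>1). (1 - t) *\<^sub>R x\<^sub>0 + t *\<^sub>R x\<^sub>1)) \<mu>"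
    "transport_cost \<beta> \<le> ennreal ((1 - t)\<^sup>2 * enn2real (transport_cost \<alpha>) + 4 * B * t\<^sup>2 + \<eta>)"
    using displacement_cost_le[OF P2 KP2[OF \<mu>s] KP2[OF \<alpha>(2)] B\<mu> B\<mu>s B0 \<alpha>(3) \<gamma>(1) h s1(1) s2(1) V e(1)
      less_imp_le[OF a] s1(4) s2(4) less_imp_le[OF t(1)] t(2)] unfolding ea by blast
  \<comment> \<open>The interpolated measure lies in \<open>K\<close> by geodesic convexity, so the
    cost of \<beta> belongs to \<open>S\<close>; the following estimates push it below
    \<open>D\<close>.\<close>
  have "D \<le> enn2real (transport_cost \<beta>)"
    using \<beta>(1) \<gamma>(2)[of t] t by (intro SD) (auto simp: S_def)
  also have "\<dots> \<le> (1 - t)\<^sup>2 * enn2real (transport_cost \<alpha>) + 4 * B * t\<^sup>2 + \<eta>"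
    using B0 \<eta> by (intro enn2real_leI \<beta>(2)) auto
  also have "\<dots> \<le> (1 - t)\<^sup>2 * (D + \<eta>) + 4 * B * t\<^sup>2 + \<eta>"
    using \<alpha>(1) B0 by (intro add_mono mult_left_mono) auto
  also have "\<dots> \<le> (1 - t)\<^sup>2 * D + 1 * \<eta> + 4 * B * t\<^sup>2 + \<eta>"
    unfolding distrib_left using t \<eta> D B0 by (intro add_mono mult_right_mono) (auto simp: power_le_one)
  also have "\<dots> = D - 2 * t * D + t * (t * (D + 4 * B)) + 2 * \<eta>"
    by (simp add: power2_eq_square algebra_simps)
  also have "\<dots> = D - 2 * \<eta>"
    unfolding t(3) by (simp add: \<eta>_def)
  finally show False using \<eta> by simp
qed

theorem corollary4p6:
  fixes K :: "'h::{real_inner, polish_space} measure set"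
  assumes "geodesically_convex K"
    and "closedin W2_topology K"
  shows "sequentially_closedin P2w_topology K \<and>
    (\<forall>\<mu>s \<mu>. (\<forall>n. \<mu>s n \<in> K) \<longrightarrow> (SUP n. second_moment (\<mu>s n)) < \<infinity> \<longrightarrow>
       \<mu> \<in> borel_prob \<longrightarrow> weakly_narrowly_converges \<mu>s \<mu> \<longrightarrow> \<mu> \<in> K)"
proof (intro conjI allI impI)
  have KP2: "K \<subseteq> P2" using assms(1) by (simp add: geodesically_convex_def)
  show "sequentially_closedin P2w_topology K"
    unfolding sequentially_closedin_def
  proof (intro conjI allI impI; (elim conjE)?)
    show "K \<subseteq> topspace P2w_topology" using KP2 by simp
    fix \<mu>s \<mu> assume \<mu>s: "\<forall>n. \<mu>s n \<in> K" and lim: "limitin P2w_topology \<mu>s \<mu> sequentially"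
    \<comment> \<open>Convergence in \<open>P2w_topology\<close> yields both the moment bound and
      narrow convergence, which reduces the first claim to the second.\<close>
    have "\<mu> \<in> borel_prob" using lim by (simp add: limitin_def P2_def)
    moreover have "(SUP n. second_moment (\<mu>s n)) < \<infinity>"
      by (rule P2w_limitin_imp_bounded_second_moments[OF lim]) (use \<mu>s KP2 in blast)
    ultimately show "\<mu> \<in> K"
      using weak_limit_in_convex_closed[OF assms] \<mu>s P2w_limitin_imp_weakly_narrowly[OF lim] by blast
  qed
qed (use weak_limit_in_convex_closed[OF assms] in blast)

end
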